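(* Let $\mathbb{N}$ denote the set of all non-negative integers and let $\mathcal{S}\subset\mathbb{N}$ be such that $\sum_{s\in\mathcal{S}}\frac{1}{s+1}<\infty$. Let $\mathcal{N}$ be the subspace of $\mathcal{P}$ spanned by the monomials $\{z^m: m\in\mathbb{N}\setminus\mathcal{S}\}$ and let $\mathcal{N}^*=\{\bar g: g\in\mathcal{N}\}$. Let $\nu$ be a complex regular Borel measure on $\mathbb{C}$ with compact support. Let $T_\nu$ be the linear operator from $\mathcal{N}$ to the space of linear functionals on $\mathcal{N}^*$ defined by $T_\nu f(\bar g)=\int_{\mathbb{C}}f\bar g\,\mathrm{d}\nu$ for all $f,g\in\mathcal{N}$. Then $T_\nu$ has finite rank if and only if the support of $\nu$ is finite.
   Context: $\mathcal{P}$ denotes the complex vector space of all polynomials in the variable $z$ with complex coefficients. $T_\nu$ has finite rank if its range is a finite-dimensional vector space. *)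

theory Defs
  imports "HOL-Analysis.Analysis" "HOL-Library.Function_Algebras"
begin

section \<open>Complex measures\<close>

text \<open>
  A complex measure is a countably additive set function on the measurable sets of \<open>M\<close>;
  only the measurable space of \<open>M\<close> is used. The values of \<open>\<nu>\<close> on non-measurable sets are
  irrelevant. Since \<open>sums\<close> holds for every enumeration of the same disjoint family, the
  convergence is unconditional.
\<close>

definition complex_measure :: "'a measure \<Rightarrow> ('a set \<Rightarrow> complex) \<Rightarrow> bool" where
  "complex_measure M \<nu> \<longleftrightarrow>
     \<nu> {} = 0 \<and>
     (\<forall>A :: nat \<Rightarrow> 'a set. range A \<subseteq> sets M \<longrightarrow> disjoint_family A \<longrightarrow>
        (\<lambda>n. \<nu> (A n)) sums \<nu> (\<Union>n. A n))"

definition total_variation :: "'a measure \<Rightarrow> ('a set \<Rightarrow> complex) \<Rightarrow> 'a measure" where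
  "total_variation M \<nu> = measure_of (space M) (sets M)
     (\<lambda>E. SUP A \<in> {A :: nat \<Rightarrow> 'a set. range A \<subseteq> sets M \<and> disjoint_family A \<and> (\<Union>n. A n) = E}.
            (\<Sum>n. ennreal (norm (\<nu> (A n)))))"

text \<open>
  The positive part of the Jordan decomposition of a real (signed) measure \<open>\<mu>\<close>,
  \<open>\<mu>\<^sup>+(E) = sup {\<mu>(F) | F \<subseteq> E}\<close>. Truncation by \<^const>\<open>ennreal\<close> at \<open>0\<close> does not
  matter because of \<open>F = {}\<close>. The negative part is the positive part of \<open>-\<mu>\<close>.
\<close>

definition positive_variation :: "'a measure \<Rightarrow> ('a set \<Rightarrow> real) \<Rightarrow> 'a measure" where
  "positive_variation M \<mu> = measure_of (space M) (sets M)
     (\<lambda>E. SUP F \<in> {F \<in> sets M. F \<subseteq> E}. ennreal (\<mu> F))"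

definition signed_integral :: "'a measure \<Rightarrow> ('a set \<Rightarrow> real) \<Rightarrow> ('a \<Rightarrow> complex) \<Rightarrow> complex" where
  "signed_integral M \<mu> f =
     integral\<^sup>L (positive_variation M \<mu>) f - integral\<^sup>L (positive_variation M (\<lambda>E. - \<mu> E)) f"

definition complex_integral :: "'a measure \<Rightarrow> ('a set \<Rightarrow> complex) \<Rightarrow> ('a \<Rightarrow> complex) \<Rightarrow> complex" where
  "complex_integral M \<nu> f =
     signed_integral M (\<lambda>E. Re (\<nu> E)) f + \<i> * signed_integral M (\<lambda>E. Im (\<nu> E)) f"

definition regular_complex_measure :: "('a::topological_space set \<Rightarrow> complex) \<Rightarrow> bool" where
  "regular_complex_measure \<nu> \<longleftrightarrow>
     (\<forall>E \<in> sets borel.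
        emeasure (total_variation borel \<nu>) E =
          (INF U \<in> {U. open U \<and> E \<subseteq> U}. emeasure (total_variation borel \<nu>) U) \<and>
        emeasure (total_variation borel \<nu>) E =
          (SUP K \<in> {K. compact K \<and> K \<in> sets borel \<and> K \<subseteq> E}. emeasure (total_variation borel \<nu>) K))"

definition measure_support :: "('a::topological_space set \<Rightarrow> complex) \<Rightarrow> 'a set" where
  "measure_support \<nu> =
     {x. \<forall>U. open U \<longrightarrow> x \<in> U \<longrightarrow> emeasure (total_variation borel \<nu>) U \<noteq> 0}"


section \<open>The polynomial spaces and the operator\<close>

interpretation poly_vs: vector_space "smult :: complex \<Rightarrow> complex poly \<Rightarrow> complex poly"
  by unfold_locales (simp_all add: smult_add_right smult_add_left)

definition monomial_span :: "nat set \<Rightarrow> complex poly set" where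
  "monomial_span S = poly_vs.span {monom 1 m | m. m \<notin> S}"

definition conj_space :: "complex poly set \<Rightarrow> (complex \<Rightarrow> complex) set" where
  "conj_space N = {\<lambda>z. cnj (poly g z) | g. g \<in> N}"

text \<open>
  A linear functional on \<open>V = conj_space N\<close> is represented by the function on all of
  \<^typ>\<open>complex \<Rightarrow> complex\<close> that agrees with it on \<open>V\<close> and is \<open>0\<close> outside \<open>V\<close>; these
  representatives are added and scaled pointwise.
\<close>

interpretation functional_vs:
  vector_space "\<lambda>(c::complex) (\<phi> :: (complex \<Rightarrow> complex) \<Rightarrow> complex) h. c * \<phi> h"
  by unfold_locales (auto simp: fun_eq_iff algebra_simps)

definition toeplitz ::
  "(complex set \<Rightarrow> complex) \<Rightarrow> complex poly set \<Rightarrow> complex poly \<Rightarrow> ((complex \<Rightarrow> complex) \<Rightarrow> complex)"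
where
  "toeplitz \<nu> N f =
     (\<lambda>h. if h \<in> conj_space N then complex_integral borel \<nu> (\<lambda>z. poly f z * h z) else 0)"

definition finite_rank :: "complex poly set \<Rightarrow> (complex poly \<Rightarrow> ((complex \<Rightarrow> complex) \<Rightarrow> complex)) \<Rightarrow> bool" where
  "finite_rank N T \<longleftrightarrow> (\<exists>B. finite B \<and> functional_vs.span B = T ` N)"

end

theory Submission
  imports Defs "HOL-Complex_Analysis.Complex_Analysis" "Jordan_Normal_Form.Determinant"
begin

text \<open>
  Write \<open>L \<phi>\<close> for the integral of \<open>\<phi>\<close> against \<open>\<nu>\<close>. Finite rank implies that all minors of a
  certain size of the matrix \<open>L (z ^ m * cnj z ^ k)\<close> with \<open>m, k \<notin> S\<close> vanish. For fixed row
  indices \<open>m\<^sub>i\<close> and column indices \<open>k\<^sub>j\<close>, the minor with indices \<open>m\<^sub>i + l\<close> and \<open>k\<^sub>j + l\<close> is, as a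
  function of \<open>l\<close>, a moment sequence on a bounded interval that vanishes off a set \<open>A\<close> with
  \<open>(\<Sum>s\<in>A. 1 / (s + 1)) < \<infinity>\<close>, so by the Muentz theorem it vanishes at \<open>l = 1\<close>. Hence the full
  moment matrix of \<open>\<bar>z\<bar>\<^sup>2 \<nu>\<close> has finite rank. Its exponential moments
  \<open>L (\<bar>z\<bar>\<^sup>2 z ^ n cnj z ^ l exp (a z + b cnj z))\<close> then factor through a finite matrix; on
  \<open>b = - cnj a\<close> they are bounded, and Liouville's theorem yields a polynomial \<open>f \<noteq> 0\<close> with
  \<open>L (\<bar>z\<bar>\<^sup>2 f(z) z ^ u cnj z ^ k) = 0\<close> for all \<open>u, k\<close>. By Stone-Weierstrass the measure
  \<open>\<bar>z\<bar>\<^sup>2 f \<nu>\<close> is \<open>0\<close>, so \<open>\<nu>\<close> lives on the finite zero set of \<open>z f(z)\<close>.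
\<close>

section \<open>Variations of signed and complex measures\<close>

text \<open>For a positive measure, a polynomial \<open>f\<close> annihilating all
  \<open>cnj z ^ y\<close> makes the integral of \<open>|f|^2\<close> vanish, and little would be
  left to prove. For a complex measure such an \<open>f\<close> alone gives nothing: the kernel of
  the moment matrix is only a linear space of polynomials, and nothing is known about
  \<open>f(z) z ^ u\<close>. The parameter \<open>a\<close> in \<open>exp (a z)\<close> overcomes
  this: once the coefficients of a relation between rows are independent of \<open>a\<close>, its
  Taylor coefficients in \<open>a\<close> give the relation for every \<open>f(z) z ^ u\<close>.
  Rows and columns are shifted by the same \<open>l\<close> because the integrand then changes only
  by powers of the real quantity \<open>|z|^2\<close>, so that a theorem about one real variable
  applies. It is applied at \<open>l = 1\<close>, since on an interval containing \<open>0\<close>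
  the constant \<open>1\<close> cannot be approximated by positive powers. This is the origin of the
  weight \<open>|z|^2\<close> and the reason why the point \<open>0\<close> joins the zeros of
  \<open>f\<close>.\<close>

lemma countably_additive_of_superadditive:
  fixes f :: "'a set \<Rightarrow> ennreal"
  assumes emp: "f {} = 0"
    and super: "\<And>A B. A \<in> sets M \<Longrightarrow> B \<in> sets M \<Longrightarrow> A \<inter> B = {} \<Longrightarrow> f A + f B \<le> f (A \<union> B)"
    and sub: "\<And>A. range A \<subseteq> sets M \<Longrightarrow> disjoint_family A \<Longrightarrow> f (\<Union>n. A n) \<le> (\<Sum>n. f (A n))"
  shows "countably_additive (sets M) f"
  unfolding countably_additive_def
proof (intro allI impI antisym)
  fix A :: "nat \<Rightarrow> 'a set"
  assume A: "range A \<subseteq> sets M" and disj: "disjoint_family A"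
  \<comment> \<open>Superadditivity with the difference set gives monotonicity, which carries the
    bound for finite unions over to the countable union.\<close>
  have mono: "f X \<le> f Y" if "X \<in> sets M" "Y \<in> sets M" "X \<subseteq> Y" for X Y
  proof -
    have "f X \<le> f X + f (Y - X)" by simp
    also have "\<dots> \<le> f (X \<union> (Y - X))" using that by (intro super) auto
    also have "X \<union> (Y - X) = Y" using that by auto
    finally show ?thesis .
  qed
  have part: "(\<Sum>i<n. f (A i)) \<le> f (\<Union>i<n. A i)" for n
  proof (induction n)
    case (Suc n)
    have "(\<Sum>i<Suc n. f (A i)) \<le> f (\<Union>i<n. A i) + f (A n)"
      using Suc by (simp add: add_right_mono)
    also have "\<dots> \<le> f ((\<Union>i<n. A i) \<union> A n)"
    proof (rule super)
      have "A i \<inter> A n = {}" if "i < n" for i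
        using disjoint_family_onD[OF disj, of i n] that by simp
      then show "(\<Union>i<n. A i) \<inter> A n = {}" by blast
    qed (use A in auto)
    also have "(\<Union>i<n. A i) \<union> A n = (\<Union>i<Suc n. A i)" by (auto simp: less_Suc_eq)
    finally show ?case .
  qed (simp add: emp)
  have "(\<Sum>i<n. f (A i)) \<le> f (\<Union>i. A i)" for n
  proof -
    have "f (\<Union>i<n. A i) \<le> f (\<Union>i. A i)" using A by (intro mono) auto
    with part[of n] show ?thesis by (rule order_trans)
  qed
  then show "(\<Sum>i. f (A i)) \<le> f (\<Union>i. A i)"
    by (intro suminf_le_const) auto
qed (rule sub)

section \<open>Signed measures and the Jordan decomposition\<close>

locale signed_measure =
  fixes M :: "'a measure" and \<mu> :: "'a set \<Rightarrow> real"
  assumes empty: "\<mu> {} = 0"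
    and sums_UN: "\<And>A. range A \<subseteq> sets M \<Longrightarrow> disjoint_family A \<Longrightarrow> (\<lambda>n. \<mu> (A n)) sums \<mu> (\<Union>n. A n)"
begin

lemma Un:
  assumes "A \<in> sets M" "B \<in> sets M" "A \<inter> B = {}"
  shows "\<mu> (A \<union> B) = \<mu> A + \<mu> B"
proof -
  have "(\<lambda>n. \<mu> (binaryset A B n)) sums \<mu> (\<Union>n. binaryset A B n)"
    using assms by (intro sums_UN) (auto simp: range_binaryset_eq disjoint_family_on_def binaryset_def)
  moreover have "(\<lambda>n. \<mu> (binaryset A B n)) sums (\<mu> A + \<mu> B)"
    using empty by (rule binaryset_sums)
  ultimately show ?thesis by (simp add: UN_binaryset_eq sums_iff)
qed

lemma Diff:
  assumes "A \<in> sets M" "B \<in> sets M" "A \<subseteq> B"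
  shows "\<mu> (B - A) = \<mu> B - \<mu> A"
  using Un[of A "B - A"] assms by (auto simp: Un_absorb1)

lemma uminus: "signed_measure M (\<lambda>E. - \<mu> E)"
  using empty sums_UN by unfold_locales (auto intro: sums_minus)

text \<open>Otherwise there is a decreasing sequence of sets on each of which \<open>\<mu>\<close>
  is unbounded, every step cutting off a piece of measure at least \<open>1\<close> in absolute
  value. The pieces are disjoint, so their measures would have to tend to \<open>0\<close>.\<close>

lemma bounded: "\<exists>C. \<forall>F \<in> sets M. \<bar>\<mu> F\<bar> \<le> C"
proof (rule ccontr)
  define P where "P E \<longleftrightarrow> E \<in> sets M \<and> \<not> (\<exists>C. \<forall>F \<in> sets M. F \<subseteq> E \<longrightarrow> \<bar>\<mu> F\<bar> \<le> C)" for E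
  assume "\<nexists>C. \<forall>F \<in> sets M. \<bar>\<mu> F\<bar> \<le> C"
  then have base: "P (space M)"
    unfolding P_def by (metis sets.sets_into_space sets.top)
  have step: "\<exists>E'. P E' \<and> E' \<subseteq> E \<and> 1 \<le> \<bar>\<mu> (E - E')\<bar>" if PE: "P E" for E
  proof -
    have E: "E \<in> sets M" using that by (simp add: P_def)
    \<comment> \<open>The margin \<open>1 + |\<mu> E|\<close> makes both \<open>|\<mu> A|\<close>
      and \<open>|\<mu> (E - A)|\<close> exceed \<open>1\<close>, so whichever half is still
      unbounded can be kept.\<close>
    obtain A where A: "A \<in> sets M" "A \<subseteq> E" and big: "\<bar>\<mu> A\<bar> > 1 + \<bar>\<mu> E\<bar>"
    proof -
      have "\<not> (\<forall>F \<in> sets M. F \<subseteq> E \<longrightarrow> \<bar>\<mu> F\<bar> \<le> 1 + \<bar>\<mu> E\<bar>)"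
        using PE unfolding P_def by blast
      then show thesis using that by (auto simp: not_le)
    qed
    have D: "\<mu> (E - A) = \<mu> E - \<mu> A" using A E by (intro Diff)
    have EE: "E - (E - A) = A" using A by auto
    have "P A \<or> P (E - A)"
    proof (rule ccontr)
      assume "\<not> (P A \<or> P (E - A))"
      then obtain C1 C2 where C1: "\<And>F. F \<in> sets M \<Longrightarrow> F \<subseteq> A \<Longrightarrow> \<bar>\<mu> F\<bar> \<le> C1"
        and C2: "\<And>F. F \<in> sets M \<Longrightarrow> F \<subseteq> E - A \<Longrightarrow> \<bar>\<mu> F\<bar> \<le> C2"
        using A E sets.Diff[OF E A(1)] unfolding P_def by metis
      have "\<bar>\<mu> F\<bar> \<le> C1 + C2" if F: "F \<in> sets M" "F \<subseteq> E" for F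
      proof -
        have "\<mu> F = \<mu> ((F \<inter> A) \<union> (F - A))" by (simp add: Int_Diff_Un)
        also have "\<dots> = \<mu> (F \<inter> A) + \<mu> (F - A)" using F A by (intro Un) auto
        finally show ?thesis
          using C1[of "F \<inter> A"] C2[of "F - A"] F A by fastforce
      qed
      then show False using that unfolding P_def by blast
    qed
    then show ?thesis
    proof
      assume "P A" then show ?thesis using A D big by (intro exI[of _ A]) auto
    next
      assume "P (E - A)" then show ?thesis using A big EE by (intro exI[of _ "E - A"]) auto
    qed
  qed
  obtain E where E: "\<And>n. P (E n)" and E2: "\<And>n. E (Suc n) \<subseteq> E n \<and> 1 \<le> \<bar>\<mu> (E n - E (Suc n))\<bar>"
    using dependent_nat_choice[of "\<lambda>n. P" "\<lambda>n E E'. E' \<subseteq> E \<and> 1 \<le> \<bar>\<mu> (E - E')\<bar>"] base step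
    by metis
  have anti: "E m \<subseteq> E n" if "n \<le> m" for m n
    by (rule lift_Suc_antimono_le[OF _ that]) (use E2 in auto)
  have disj: "disjoint_family (\<lambda>n. E n - E (Suc n))"
    unfolding disjoint_family_on_def
  proof (intro ballI impI)
    fix m n :: nat assume "m \<noteq> n"
    then consider "Suc m \<le> n" | "Suc n \<le> m" by linarith
    then show "(E m - E (Suc m)) \<inter> (E n - E (Suc n)) = {}"
      using anti by cases (blast dest: anti)+
  qed
  have "(\<lambda>n. \<mu> (E n - E (Suc n))) sums \<mu> (\<Union>n. E n - E (Suc n))"
    using E by (intro sums_UN disj) (auto simp: P_def)
  then have "(\<lambda>n. \<mu> (E n - E (Suc n))) \<longlonglongrightarrow> 0"
    by (intro summable_LIMSEQ_zero sums_summable)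
  then have "\<forall>\<^sub>F n in sequentially. dist (\<mu> (E n - E (Suc n))) 0 < 1"
    by (rule tendstoD) simp
  then obtain n where "\<bar>\<mu> (E n - E (Suc n))\<bar> < 1"
    by (auto simp: eventually_sequentially dist_real_def)
  with E2[of n] show False by simp
qed

lemma countably_additive_positive_variation:
  "countably_additive (sets M) (\<lambda>E. SUP F \<in> {F \<in> sets M. F \<subseteq> E}. ennreal (\<mu> F))"
proof (rule countably_additive_of_superadditive)
  show "(SUP F \<in> {F \<in> sets M. F \<subseteq> {}}. ennreal (\<mu> F)) = 0"
  proof -
    have "{F \<in> sets M. F \<subseteq> {}} = {{}}" by auto
    then show ?thesis by (simp add: empty)
  qed
next
  fix A B assume AB: "A \<in> sets M" "B \<in> sets M" "A \<inter> B = {}"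
  let ?S = "SUP H \<in> {H \<in> sets M. H \<subseteq> A \<union> B}. ennreal (\<mu> H)"
  have ne: "{F \<in> sets M. F \<subseteq> X} \<noteq> {}" for X by auto
  have upper: "ennreal (\<mu> H) \<le> ?S" if "H \<in> sets M" "H \<subseteq> A \<union> B" for H
    using that by (intro SUP_upper) auto
  have "ennreal (\<mu> F) + ennreal (\<mu> G) \<le> ?S"
    if FG: "F \<in> sets M" "F \<subseteq> A" "G \<in> sets M" "G \<subseteq> B" for F G
  proof (cases "0 \<le> \<mu> F \<and> 0 \<le> \<mu> G")
    case True
    then have "ennreal (\<mu> F) + ennreal (\<mu> G) = ennreal (\<mu> F + \<mu> G)" by simp
    also have "\<mu> F + \<mu> G = \<mu> (F \<union> G)" using FG AB by (intro Un[symmetric]) auto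
    also have "ennreal (\<mu> (F \<union> G)) \<le> ?S" using FG by (intro upper) auto
    finally show ?thesis .
  next
    case False
    \<comment> \<open>A set of negative measure contributes \<open>0\<close> after truncation, so
      the other set alone serves as competitor.\<close>
    then consider "\<mu> F < 0" | "\<mu> G < 0" by linarith
    then show ?thesis
    proof cases
      case 1
      then show ?thesis using upper[of G] FG by (simp add: ennreal_neg le_supI2)
    next
      case 2
      then show ?thesis using upper[of F] FG by (simp add: ennreal_neg le_supI1)
    qed
  qed
  then show "(SUP F \<in> {F \<in> sets M. F \<subseteq> A}. ennreal (\<mu> F)) + (SUP F \<in> {F \<in> sets M. F \<subseteq> B}. ennreal (\<mu> F)) \<le> ?S"
    by (auto simp flip: ennreal_SUP_add_left[OF ne] simp: ennreal_SUP_add_right[OF ne] intro!: SUP_least)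
next
  fix A :: "nat \<Rightarrow> 'a set" assume A: "range A \<subseteq> sets M" and disj: "disjoint_family A"
  let ?p = "\<lambda>E. SUP F \<in> {F \<in> sets M. F \<subseteq> E}. ennreal (\<mu> F)"
  show "?p (\<Union>n. A n) \<le> (\<Sum>n. ?p (A n))"
  proof (rule SUP_least)
    fix F assume "F \<in> {F \<in> sets M. F \<subseteq> (\<Union>n. A n)}"
    then have F: "F \<in> sets M" and eq: "(\<Union>n. F \<inter> A n) = F" by auto
    have "(\<lambda>n. \<mu> (F \<inter> A n)) sums \<mu> F"
      using sums_UN[of "\<lambda>n. F \<inter> A n"] F A disj
      by (simp add: eq[simplified] image_subset_iff disjoint_family_on_def) blast
    then have "(\<lambda>n. ennreal (\<Sum>i<n. \<mu> (F \<inter> A i))) \<longlonglongrightarrow> ennreal (\<mu> F)"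
      unfolding sums_def by (rule tendsto_ennrealI)
    then show "ennreal (\<mu> F) \<le> (\<Sum>n. ?p (A n))"
    proof (rule LIMSEQ_le_const2, intro exI allI impI)
      fix n
      \<comment> \<open>Truncation at \<open>0\<close> makes \<open>ennreal\<close> subadditive even
        for terms of mixed sign.\<close>
      have "ennreal (\<Sum>i<n. \<mu> (F \<inter> A i)) \<le> (\<Sum>i<n. ennreal (\<mu> (F \<inter> A i)))"
      proof (induction n)
        case (Suc n)
        have max0: "ennreal (max 0 x) = ennreal x" for x :: real
          by (cases "0 \<le> x") (simp_all add: ennreal_neg max_def)
        have plus_le: "ennreal (x + y) \<le> ennreal x + ennreal y" for x y :: real
          using ennreal_leI[of "x + y" "max 0 x + max 0 y"] by (simp add: max0)
        have "ennreal (\<Sum>i<Suc n. \<mu> (F \<inter> A i)) \<le> ennreal (\<Sum>i<n. \<mu> (F \<inter> A i)) + ennreal (\<mu> (F \<inter> A n))"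
          using plus_le by simp
        also have "\<dots> \<le> (\<Sum>i<Suc n. ennreal (\<mu> (F \<inter> A i)))"
          using Suc by (simp add: add_right_mono)
        finally show ?case .
      qed simp
      also have "\<dots> \<le> (\<Sum>i<n. ?p (A i))"
        using F A by (intro sum_mono SUP_upper) auto
      also have "\<dots> \<le> (\<Sum>n. ?p (A n))" by (intro sum_le_suminf) auto
      finally show "ennreal (\<Sum>i<n. \<mu> (F \<inter> A i)) \<le> (\<Sum>n. ?p (A n))" .
    qed
  qed
qed

lemma sets_positive_variation [simp]: "sets (positive_variation M \<nu>) = sets M"
  and space_positive_variation [simp]: "space (positive_variation M \<nu>) = space M"
  by (simp_all add: positive_variation_def)

lemma emeasure_positive_variation:
  assumes "E \<in> sets M"
  shows "emeasure (positive_variation M \<mu>) E = (SUP F \<in> {F \<in> sets M. F \<subseteq> E}. ennreal (\<mu> F))"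
proof (rule emeasure_measure_of[OF positive_variation_def])
  have "{F \<in> sets M. F \<subseteq> {}} = {{}}" by auto
  then show "positive (sets (positive_variation M \<mu>)) (\<lambda>E. SUP F \<in> {F \<in> sets M. F \<subseteq> E}. ennreal (\<mu> F))"
    by (simp add: positive_def empty)
qed (use assms countably_additive_positive_variation in \<open>auto simp: sets.space_closed\<close>)

lemma finite_measure_positive_variation: "finite_measure (positive_variation M \<mu>)"
proof
  obtain C where C: "\<And>F. F \<in> sets M \<Longrightarrow> \<bar>\<mu> F\<bar> \<le> C" using bounded by blast
  have "emeasure (positive_variation M \<mu>) (space M) \<le> ennreal C"
    unfolding emeasure_positive_variation[OF sets.top]
    using C by (intro SUP_least ennreal_leI) (auto simp: abs_le_iff)
  then show "emeasure (positive_variation M \<mu>) (space (positive_variation M \<mu>)) \<noteq> \<infinity>"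
    by (auto simp: top_unique)
qed

text \<open>The identity \<open>\<mu> F = \<mu> E - \<mu> (E - F)\<close> exchanges competitors for
  the positive variation with competitors for the negative one, so no Hahn decomposition is
  involved. Both variations are finite by \<open>bounded\<close>, which allows the
  subtraction.\<close>

lemma Jordan_decomposition:
  assumes E: "E \<in> sets M"
  shows "\<mu> E = measure (positive_variation M \<mu>) E - measure (positive_variation M (\<lambda>E. - \<mu> E)) E"
proof -
  interpret neg: signed_measure M "\<lambda>E. - \<mu> E" by (rule uminus)
  interpret p: finite_measure "positive_variation M \<mu>" by (rule finite_measure_positive_variation)
  interpret n: finite_measure "positive_variation M (\<lambda>E. - \<mu> E)" by (rule neg.finite_measure_positive_variation)
  let ?p = "measure (positive_variation M \<mu>) E" and ?n = "measure (positive_variation M (\<lambda>E. - \<mu> E)) E"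
  have p: "\<mu> F \<le> ?p" if "F \<in> sets M" "F \<subseteq> E" for F
  proof -
    have "ennreal (\<mu> F) \<le> ennreal ?p"
      unfolding p.emeasure_eq_measure[symmetric] emeasure_positive_variation[OF E]
      using that by (intro SUP_upper) auto
    then show ?thesis by (simp add: ennreal_le_iff)
  qed
  have n: "- \<mu> F \<le> ?n" if "F \<in> sets M" "F \<subseteq> E" for F
  proof -
    have "ennreal (- \<mu> F) \<le> ennreal ?n"
      unfolding n.emeasure_eq_measure[symmetric] neg.emeasure_positive_variation[OF E]
      using that by (intro SUP_upper) auto
    then show ?thesis by (simp add: ennreal_le_iff)
  qed
  have "ennreal ?p \<le> ennreal (\<mu> E + ?n)"
    unfolding p.emeasure_eq_measure[symmetric] emeasure_positive_variation[OF E]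
  proof (intro SUP_least ennreal_leI)
    fix F assume "F \<in> {F \<in> sets M. F \<subseteq> E}"
    then show "\<mu> F \<le> \<mu> E + ?n" using n[of "E - F"] Diff[of F E] E by auto
  qed
  moreover have "ennreal ?n \<le> ennreal (- \<mu> E + ?p)"
    unfolding n.emeasure_eq_measure[symmetric] neg.emeasure_positive_variation[OF E]
  proof (intro SUP_least ennreal_leI)
    fix F assume "F \<in> {F \<in> sets M. F \<subseteq> E}"
    then show "- \<mu> F \<le> - \<mu> E + ?p" using p[of "E - F"] Diff[of F E] E by auto
  qed
  moreover have "0 \<le> \<mu> E + ?n" "0 \<le> - \<mu> E + ?p" using p[of E] n[of E] E by auto
  ultimately show ?thesis by (simp add: ennreal_le_iff)
qed

end

section \<open>Total variation of a complex measure\<close>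

lemma norm_le_suminf_norm_of_sums:
  fixes f :: "nat \<Rightarrow> 'a::real_normed_vector"
  assumes "f sums s"
  shows "ennreal (norm s) \<le> (\<Sum>n. ennreal (norm (f n)))"
proof -
  have "(\<lambda>n. ennreal (norm (\<Sum>i<n. f i))) \<longlonglongrightarrow> ennreal (norm s)"
    using assms unfolding sums_def by (intro tendsto_ennrealI tendsto_norm)
  then show ?thesis
  proof (rule LIMSEQ_le_const2, intro exI allI impI)
    fix n
    have "ennreal (norm (\<Sum>i<n. f i)) \<le> ennreal (\<Sum>i<n. norm (f i))"
      by (intro ennreal_leI norm_sum)
    also have "\<dots> = (\<Sum>i<n. ennreal (norm (f i)))" by simp
    also have "\<dots> \<le> (\<Sum>n. ennreal (norm (f n)))" by (intro sum_le_suminf) auto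
    finally show "ennreal (norm (\<Sum>i<n. f i)) \<le> (\<Sum>n. ennreal (norm (f n)))" .
  qed
qed

lemma suminf_commute_ennreal:
  fixes f :: "nat \<Rightarrow> nat \<Rightarrow> ennreal"
  shows "(\<Sum>i. \<Sum>j. f i j) = (\<Sum>j. \<Sum>i. f i j)"
proof -
  have "(\<Sum>i. \<Sum>j. f i j) = (\<integral>\<^sup>+ i. (\<Sum>j. f i j) \<partial>count_space UNIV)"
    by (simp add: nn_integral_count_space_nat)
  also have "\<dots> = (\<Sum>j. \<integral>\<^sup>+ i. f i j \<partial>count_space UNIV)"
    by (rule nn_integral_suminf) simp
  finally show ?thesis by (simp add: nn_integral_count_space_nat)
qed

context
  fixes M :: "'a measure" and \<nu> :: "'a set \<Rightarrow> complex"
  assumes \<nu>: "complex_measure M \<nu>"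
begin

lemma complex_measure_empty: "\<nu> {} = 0"
  using \<nu> by (simp add: complex_measure_def)

lemma complex_measure_sums:
  "range A \<subseteq> sets M \<Longrightarrow> disjoint_family A \<Longrightarrow> (\<lambda>n. \<nu> (A n)) sums \<nu> (\<Union>n. A n)"
  using \<nu> by (simp add: complex_measure_def)

lemma signed_measure_Re: "signed_measure M (\<lambda>E. Re (\<nu> E))"
  and signed_measure_Im: "signed_measure M (\<lambda>E. Im (\<nu> E))"
  using complex_measure_empty complex_measure_sums
  by unfold_locales (auto intro: sums_Re sums_Im)

lemma sets_total_variation: "sets (total_variation M \<nu>) = sets M"
  by (simp add: total_variation_def)

text \<open>\<open>measure_of\<close> takes the prescribed values only if they are countably
  additive. Interleaving partitions of two disjoint sets gives superadditivity; cutting a partition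
  of a union along its pieces and exchanging the sums gives countable subadditivity.\<close>

lemma emeasure_total_variation:
  assumes "E \<in> sets M"
  shows "emeasure (total_variation M \<nu>) E =
     (SUP A \<in> {A :: nat \<Rightarrow> 'a set. range A \<subseteq> sets M \<and> disjoint_family A \<and> (\<Union>n. A n) = E}.
            (\<Sum>n. ennreal (norm (\<nu> (A n)))))"
proof (rule emeasure_measure_of[OF total_variation_def])
  let ?P = "\<lambda>E. {A :: nat \<Rightarrow> 'a set. range A \<subseteq> sets M \<and> disjoint_family A \<and> (\<Union>n. A n) = E}"
  let ?t = "\<lambda>E. SUP A \<in> ?P E. (\<Sum>n. ennreal (norm (\<nu> (A n))))"
  have t_empty: "?t {} = 0"
  proof -
    have "(\<Sum>n. ennreal (norm (\<nu> (A n)))) = 0" if "A \<in> ?P {}" for A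
      using that complex_measure_empty by auto
    then show ?thesis by (auto simp: bot_ennreal[symmetric] SUP_eq_iff SUP_bot_conv)
  qed
  then show "positive (sets (total_variation M \<nu>)) ?t" by (simp add: positive_def)
  have ne: "?P E \<noteq> {}" if "E \<in> sets M" for E
  proof -
    have "binaryset E {} \<in> ?P E"
      using that by (auto simp: range_binaryset_eq UN_binaryset_eq disjoint_family_on_def binaryset_def)
    then show ?thesis by blast
  qed
  have "countably_additive (sets M) ?t"
  proof (rule countably_additive_of_superadditive)
    show "?t {} = 0" by (rule t_empty)
  next
    fix X Y assume XY: "X \<in> sets M" "Y \<in> sets M" "X \<inter> Y = {}"
    have "(\<Sum>n. ennreal (norm (\<nu> (A n)))) + (\<Sum>n. ennreal (norm (\<nu> (B n)))) \<le> ?t (X \<union> Y)"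
      if A: "A \<in> ?P X" and B: "B \<in> ?P Y" for A B
    proof -
      define D where "D n = (if even n then A (n div 2) else B (n div 2))" for n
      have AX: "A n \<subseteq> X" and BY: "B n \<subseteq> Y" for n using A B by auto
      have "range D \<subseteq> sets M" using A B by (auto simp: D_def)
      moreover have "disjoint_family D"
        unfolding disjoint_family_on_def
      proof (intro ballI impI)
        fix m n :: nat assume "m \<noteq> n"
        then have "m div 2 \<noteq> n div 2" if "even m \<longleftrightarrow> even n"
          using that by (metis bit_eq_rec)
        moreover have "A i \<inter> B j = {}" "B j \<inter> A i = {}" for i j using AX BY XY by blast+
        ultimately show "D m \<inter> D n = {}"
          using A B by (auto simp: D_def disjoint_family_on_def)
      qed
      moreover have "(\<Union>n. D n) = X \<union> Y"
      proof
        show "(\<Union>n. D n) \<subseteq> X \<union> Y" using AX BY by (auto simp: D_def)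
        have "D (2 * n) = A n" "D (2 * n + 1) = B n" for n by (simp_all add: D_def)
        then have "A n \<subseteq> (\<Union>n. D n)" "B n \<subseteq> (\<Union>n. D n)" for n by (metis UN_upper UNIV_I)+
        then have "(\<Union>n. A n) \<subseteq> (\<Union>n. D n)" "(\<Union>n. B n) \<subseteq> (\<Union>n. D n)" by (simp_all add: UN_subset_iff)
        then show "X \<union> Y \<subseteq> (\<Union>n. D n)" using A B by simp
      qed
      ultimately have "D \<in> ?P (X \<union> Y)" by simp
      then have upper: "(\<Sum>n. ennreal (norm (\<nu> (D n)))) \<le> ?t (X \<union> Y)" by (rule SUP_upper)
      have split: "(\<Sum>i<N. ennreal (norm (\<nu> (A i))) + ennreal (norm (\<nu> (B i)))) = (\<Sum>i<2*N. ennreal (norm (\<nu> (D i))))" for N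
        by (induction N) (simp_all add: D_def add.assoc)
      have "(\<Sum>n. ennreal (norm (\<nu> (A n))) + ennreal (norm (\<nu> (B n)))) \<le> (\<Sum>n. ennreal (norm (\<nu> (D n))))"
      proof (rule suminf_le_const)
        show "(\<Sum>i<N. ennreal (norm (\<nu> (A i))) + ennreal (norm (\<nu> (B i)))) \<le> (\<Sum>n. ennreal (norm (\<nu> (D n))))" for N
          unfolding split by (intro sum_le_suminf) auto
      qed auto
      then show ?thesis using upper by (simp add: suminf_add)
    qed
    then show "?t X + ?t Y \<le> ?t (X \<union> Y)"
      using ne[OF XY(1)] ne[OF XY(2)]
      by (auto simp flip: ennreal_SUP_add_left simp: ennreal_SUP_add_right intro!: SUP_least)
  next
    fix A :: "nat \<Rightarrow> 'a set" assume A: "range A \<subseteq> sets M" and disj: "disjoint_family A"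
    show "?t (\<Union>k. A k) \<le> (\<Sum>k. ?t (A k))"
    proof (rule SUP_least)
      fix P assume "P \<in> ?P (\<Union>k. A k)"
      then have P: "range P \<subseteq> sets M" "disjoint_family P" "(\<Union>n. P n) = (\<Union>k. A k)" by auto
      have "ennreal (norm (\<nu> (P n))) \<le> (\<Sum>k. ennreal (norm (\<nu> (P n \<inter> A k))))" for n
      proof -
        have eq: "(\<Union>k. P n \<inter> A k) = P n" using P(3) by blast
        have "(\<lambda>k. \<nu> (P n \<inter> A k)) sums \<nu> (\<Union>k. P n \<inter> A k)"
          using P A disjoint_family_subset[OF disj] by (intro complex_measure_sums) auto
        then show ?thesis unfolding eq by (rule norm_le_suminf_norm_of_sums)
      qed
      then have "(\<Sum>n. ennreal (norm (\<nu> (P n)))) \<le> (\<Sum>n. \<Sum>k. ennreal (norm (\<nu> (P n \<inter> A k))))"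
        by (intro suminf_le) auto
      also have "\<dots> = (\<Sum>k. \<Sum>n. ennreal (norm (\<nu> (P n \<inter> A k))))" by (rule suminf_commute_ennreal)
      also have "\<dots> \<le> (\<Sum>k. ?t (A k))"
      proof (intro suminf_le SUP_upper)
        fix k
        have "(\<Union>n. P n \<inter> A k) = A k" using P(3) by blast
        then show "(\<lambda>n. P n \<inter> A k) \<in> ?P (A k)"
          using P A disjoint_family_subset[OF P(2)] by auto
      qed auto
      finally show "(\<Sum>n. ennreal (norm (\<nu> (P n)))) \<le> (\<Sum>k. ?t (A k))" .
    qed
  qed
  then show "countably_additive (sets (total_variation M \<nu>)) ?t" by (simp add: sets_total_variation)
qed (use assms in \<open>auto simp: sets.space_closed sets_total_variation\<close>)

lemma norm_le_total_variation:
  assumes "E \<in> sets M" "F \<in> sets M" "F \<subseteq> E"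
  shows "ennreal (norm (\<nu> F)) \<le> emeasure (total_variation M \<nu>) E"
proof -
  let ?A = "binaryset F (E - F)"
  have "ennreal (norm (\<nu> F)) = (\<Sum>i<1. ennreal (norm (\<nu> (?A i))))"
    by (simp add: binaryset_def)
  also have "\<dots> \<le> (\<Sum>i. ennreal (norm (\<nu> (?A i))))"
    by (intro sum_le_suminf) auto
  also have "\<dots> \<le> emeasure (total_variation M \<nu>) E"
    unfolding emeasure_total_variation[OF assms(1)]
    using assms by (intro SUP_upper)
      (auto simp: range_binaryset_eq UN_binaryset_eq disjoint_family_on_def binaryset_def)
  finally show ?thesis .
qed

lemma total_variation_eq_0_iff:
  assumes "E \<in> sets M"
  shows "emeasure (total_variation M \<nu>) E = 0 \<longleftrightarrow> (\<forall>F \<in> sets M. F \<subseteq> E \<longrightarrow> \<nu> F = 0)"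
proof
  assume "emeasure (total_variation M \<nu>) E = 0"
  then show "\<forall>F \<in> sets M. F \<subseteq> E \<longrightarrow> \<nu> F = 0"
    using norm_le_total_variation[OF assms] by (auto simp: ennreal_eq_0_iff)
next
  assume null: "\<forall>F \<in> sets M. F \<subseteq> E \<longrightarrow> \<nu> F = 0"
  have "(\<Sum>n. ennreal (norm (\<nu> (A n)))) = 0"
    if "range A \<subseteq> sets M" "(\<Union>n. A n) = E" for A :: "nat \<Rightarrow> 'a set"
  proof -
    have "\<nu> (A n) = 0" for n using null that by blast
    then show ?thesis by simp
  qed
  then have "emeasure (total_variation M \<nu>) E \<le> 0"
    unfolding emeasure_total_variation[OF assms] by (intro SUP_least eq_refl) blast
  then show "emeasure (total_variation M \<nu>) E = 0" by simp
qed

end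

text \<open>By definition the complement is a union of open null sets; by Lindelof countably many of
  them suffice.\<close>

lemma total_variation_Compl_measure_support:
  fixes \<nu> :: "'a::second_countable_topology set \<Rightarrow> complex"
  assumes \<nu>: "complex_measure borel \<nu>"
  shows "- measure_support \<nu> \<in> null_sets (total_variation borel \<nu>)"
proof -
  let ?F = "{U. open U \<and> emeasure (total_variation borel \<nu>) U = 0}"
  have eq: "\<Union>?F = - measure_support \<nu>" by (auto simp: measure_support_def)
  have "open U" if "U \<in> ?F" for U using that by simp
  from Lindelof[OF this] obtain F' where F': "F' \<subseteq> ?F" "countable F'" "\<Union>F' = \<Union>?F" .
  have "U \<in> null_sets (total_variation borel \<nu>)" if "U \<in> F'" for U
  proof -
    have "U \<in> ?F" using that F'(1) by (rule subsetD[rotated])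
    then show ?thesis by (simp add: null_sets_def sets_total_variation[OF \<nu>])
  qed
  then have "\<Union>F' \<in> null_sets (total_variation borel \<nu>)"
    using F'(2) null_sets_UN'[of F' id] by simp
  then show ?thesis by (simp add: F' eq)
qed

section \<open>Integration against a compactly supported complex measure\<close>

lemma (in signed_measure) AE_positive_variation:
  assumes N: "N \<in> sets M" and null: "\<And>F. F \<in> sets M \<Longrightarrow> F \<subseteq> N \<Longrightarrow> \<mu> F = 0"
  shows "AE x in positive_variation M \<mu>. x \<notin> N"
proof (rule AE_I')
  have "emeasure (positive_variation M \<mu>) N \<le> 0"
    unfolding emeasure_positive_variation[OF N] by (intro SUP_least) (simp add: null)
  then show "N \<in> null_sets (positive_variation M \<mu>)" using N by (simp add: null_sets_def)
qed auto

locale compact_complex_measure =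
  fixes \<nu> :: "complex set \<Rightarrow> complex"
  assumes \<nu>: "complex_measure borel \<nu>"
    and compact_support: "compact (measure_support \<nu>)"
begin

abbreviation "K \<equiv> measure_support \<nu>"
abbreviation "L \<equiv> complex_integral borel \<nu>"

text \<open>Polynomials are unbounded on the plane, so boundedness is asked for on the support only;
  its complement is null for each of the four \<open>parts\<close>.\<close>

definition admissible :: "(complex \<Rightarrow> complex) \<Rightarrow> bool" where
  "admissible \<phi> \<longleftrightarrow> \<phi> \<in> borel_measurable borel \<and> bounded (\<phi> ` K)"

definition parts :: "complex measure set" where
  "parts = {positive_variation borel (\<lambda>E. Re (\<nu> E)), positive_variation borel (\<lambda>E. - Re (\<nu> E)),
            positive_variation borel (\<lambda>E. Im (\<nu> E)), positive_variation borel (\<lambda>E. - Im (\<nu> E))}"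

lemma L_def:
  "L \<phi> = (integral\<^sup>L (positive_variation borel (\<lambda>E. Re (\<nu> E))) \<phi>
            - integral\<^sup>L (positive_variation borel (\<lambda>E. - Re (\<nu> E))) \<phi>)
       + \<i> * (integral\<^sup>L (positive_variation borel (\<lambda>E. Im (\<nu> E))) \<phi>
            - integral\<^sup>L (positive_variation borel (\<lambda>E. - Im (\<nu> E))) \<phi>)"
  by (simp add: complex_integral_def signed_integral_def)

sublocale Re: signed_measure borel "\<lambda>E. Re (\<nu> E)" by (rule signed_measure_Re[OF \<nu>])
sublocale Im: signed_measure borel "\<lambda>E. Im (\<nu> E)" by (rule signed_measure_Im[OF \<nu>])
sublocale mRe: signed_measure borel "\<lambda>E. - Re (\<nu> E)" by (rule Re.uminus)
sublocale mIm: signed_measure borel "\<lambda>E. - Im (\<nu> E)" by (rule Im.uminus)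

lemma finite_measure_parts: "P \<in> parts \<Longrightarrow> finite_measure P"
  using Re.finite_measure_positive_variation Im.finite_measure_positive_variation
    mRe.finite_measure_positive_variation mIm.finite_measure_positive_variation
  by (auto simp: parts_def)

lemma sets_parts: "P \<in> parts \<Longrightarrow> sets P = sets borel"
  by (auto simp: parts_def)

lemma closed_support: "closed K"
  using compact_support by (rule compact_imp_closed)

lemma vanish_off_support:
  assumes "F \<in> sets borel" "F \<subseteq> - K"
  shows "\<nu> F = 0"
proof -
  have "emeasure (total_variation borel \<nu>) (- K) = 0"
    using total_variation_Compl_measure_support[OF \<nu>] by (simp add: null_sets_def)
  then show ?thesis
    using total_variation_eq_0_iff[OF \<nu>, of "- K"] closed_support assms by auto
qed

lemma AE_parts:
  assumes "P \<in> parts"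
  shows "AE x in P. x \<in> K"
proof -
  have K: "- K \<in> sets borel" using closed_support by auto
  show ?thesis
    using assms Re.AE_positive_variation[OF K] Im.AE_positive_variation[OF K]
      mRe.AE_positive_variation[OF K] mIm.AE_positive_variation[OF K] vanish_off_support
    by (auto simp: parts_def)
qed

lemma admissible_boundE:
  assumes "admissible \<phi>"
  obtains B where "0 \<le> B" "\<And>x. x \<in> K \<Longrightarrow> norm (\<phi> x) \<le> B"
proof -
  obtain B where "\<And>x. x \<in> K \<Longrightarrow> norm (\<phi> x) \<le> B"
    using assms by (auto simp: admissible_def bounded_iff)
  then show thesis using that[of "max B 0"] by (meson max.coboundedI1 max.cobounded2)
qed

lemma admissibleI:
  assumes "\<phi> \<in> borel_measurable borel" "\<And>x. x \<in> K \<Longrightarrow> norm (\<phi> x) \<le> B"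
  shows "admissible \<phi>"
  using assms by (auto simp: admissible_def bounded_iff)

lemma admissible_continuous: "continuous_on UNIV \<phi> \<Longrightarrow> admissible \<phi>"
  unfolding admissible_def
  by (auto intro!: borel_measurable_continuous_onI compact_imp_bounded compact_continuous_image
      compact_support elim: continuous_on_subset)

lemma admissible_add: "admissible \<phi> \<Longrightarrow> admissible \<psi> \<Longrightarrow> admissible (\<lambda>x. \<phi> x + \<psi> x)"
  unfolding admissible_def by (auto intro: bounded_plus_comp)

lemma admissible_const: "admissible (\<lambda>_. c)"
  by (intro admissible_continuous continuous_intros)

lemma integrable_parts:
  assumes "P \<in> parts" "admissible \<phi>"
  shows "integrable P \<phi>"
proof -
  interpret finite_measure P using assms(1) by (rule finite_measure_parts)
  obtain B where "0 \<le> B" "\<And>x. x \<in> K \<Longrightarrow> norm (\<phi> x) \<le> B"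
    using admissible_boundE[OF assms(2)] by metis
  then have "AE x in P. norm (\<phi> x) \<le> B" using AE_parts[OF assms(1)] by (auto elim: eventually_mono)
  moreover have "\<phi> \<in> borel_measurable P"
    using assms by (simp add: admissible_def cong: measurable_cong_sets) (metis measurable_cong_sets sets_parts)
  ultimately show ?thesis by (rule integrable_const_bound)
qed

lemma integrable_positive_variations:
  assumes "admissible \<phi>"
  shows "integrable (positive_variation borel (\<lambda>E. Re (\<nu> E))) \<phi>"
    "integrable (positive_variation borel (\<lambda>E. - Re (\<nu> E))) \<phi>"
    "integrable (positive_variation borel (\<lambda>E. Im (\<nu> E))) \<phi>"
    "integrable (positive_variation borel (\<lambda>E. - Im (\<nu> E))) \<phi>"
  by (rule integrable_parts[OF _ assms], simp add: parts_def)+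

lemma L_add: "admissible \<phi> \<Longrightarrow> admissible \<psi> \<Longrightarrow> L (\<lambda>x. \<phi> x + \<psi> x) = L \<phi> + L \<psi>"
  by (simp add: L_def integrable_positive_variations algebra_simps)

lemma L_cmult: "L (\<lambda>x. c * \<phi> x) = c * L \<phi>"
  by (simp add: L_def algebra_simps)

lemma L_minus: "admissible \<phi> \<Longrightarrow> admissible \<psi> \<Longrightarrow> L (\<lambda>x. \<phi> x - \<psi> x) = L \<phi> - L \<psi>"
  by (simp add: L_def integrable_positive_variations algebra_simps)

lemma L_zero: "L (\<lambda>_. 0) = 0"
  by (simp add: L_def)

lemma admissible_sum: "(\<And>i. i \<in> I \<Longrightarrow> admissible (\<phi> i)) \<Longrightarrow> admissible (\<lambda>x. \<Sum>i\<in>I. \<phi> i x)"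
  by (induction I rule: infinite_finite_induct) (auto intro: admissible_add admissible_const)

lemma L_sum:
  assumes "\<And>i. i \<in> I \<Longrightarrow> admissible (\<phi> i)"
  shows "L (\<lambda>x. \<Sum>i\<in>I. \<phi> i x) = (\<Sum>i\<in>I. L (\<phi> i))"
  using assms
  by (induction I rule: infinite_finite_induct) (auto simp: L_zero L_add admissible_sum)

text \<open>The constant is the sum of the total masses of the four parts. This is cruder than the
  total variation, but only continuity for uniform convergence on the support matters.\<close>

lemma L_bound:
  obtains C where "0 \<le> C"
    "\<And>\<phi> B. \<phi> \<in> borel_measurable borel \<Longrightarrow> (\<And>x. x \<in> K \<Longrightarrow> norm (\<phi> x) \<le> B) \<Longrightarrow> 0 \<le> B \<Longrightarrow> norm (L \<phi>) \<le> C * B"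
proof -
  define C where "C P = measure P (space P)" for P :: "complex measure"
  let ?p1 = "positive_variation borel (\<lambda>E. Re (\<nu> E))" and ?p2 = "positive_variation borel (\<lambda>E. - Re (\<nu> E))"
    and ?p3 = "positive_variation borel (\<lambda>E. Im (\<nu> E))" and ?p4 = "positive_variation borel (\<lambda>E. - Im (\<nu> E))"
  have 1: "norm (integral\<^sup>L P \<phi>) \<le> C P * B"
    if P: "P \<in> parts" and \<phi>: "\<phi> \<in> borel_measurable borel" "\<And>x. x \<in> K \<Longrightarrow> norm (\<phi> x) \<le> B" for P B and \<phi> :: "complex \<Rightarrow> complex"
  proof -
    interpret finite_measure P using P by (rule finite_measure_parts)
    have int: "integrable P \<phi>" using P \<phi> by (intro integrable_parts admissibleI)
    have "norm (integral\<^sup>L P \<phi>) \<le> (\<integral>x. norm (\<phi> x) \<partial>P)" by (rule integral_norm_bound)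
    also have "\<dots> \<le> (\<integral>x. B \<partial>P)"
      using int AE_parts[OF P] \<phi>(2) by (intro integral_mono_AE) (auto elim: eventually_mono)
    finally show ?thesis by (simp add: C_def)
  qed
  have in_parts: "?p1 \<in> parts" "?p2 \<in> parts" "?p3 \<in> parts" "?p4 \<in> parts" by (simp_all add: parts_def)
  show thesis
  proof (rule that[of "C ?p1 + C ?p2 + (C ?p3 + C ?p4)"])
    show "0 \<le> C ?p1 + C ?p2 + (C ?p3 + C ?p4)" by (simp add: C_def)
    fix \<phi> :: "complex \<Rightarrow> complex" and B
    assume \<phi>: "\<phi> \<in> borel_measurable borel" "\<And>x. x \<in> K \<Longrightarrow> norm (\<phi> x) \<le> B" "0 \<le> B"
    have "norm (L \<phi>) \<le> (norm (integral\<^sup>L ?p1 \<phi>) + norm (integral\<^sup>L ?p2 \<phi>))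
        + (norm (integral\<^sup>L ?p3 \<phi>) + norm (integral\<^sup>L ?p4 \<phi>))"
      unfolding L_def
      by (rule order_trans[OF norm_triangle_ineq]) (auto simp: norm_mult intro!: add_mono norm_triangle_ineq4)
    also have "\<dots> \<le> (C ?p1 * B + C ?p2 * B) + (C ?p3 * B + C ?p4 * B)"
      using 1[OF in_parts(1) \<phi>(1,2)] 1[OF in_parts(2) \<phi>(1,2)] 1[OF in_parts(3) \<phi>(1,2)] 1[OF in_parts(4) \<phi>(1,2)]
      by (intro add_mono)
    also have "\<dots> = (C ?p1 + C ?p2 + (C ?p3 + C ?p4)) * B" by (simp add: algebra_simps)
    finally show "norm (L \<phi>) \<le> (C ?p1 + C ?p2 + (C ?p3 + C ?p4)) * B" .
  qed
qed

text \<open>The difference is bounded by \<open>0\<close> on the support, so \<open>L_bound\<close>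
  applies with \<open>B = 0\<close>.\<close>

lemma L_cong:
  assumes "admissible \<phi>" "admissible \<psi>" "\<And>x. x \<in> K \<Longrightarrow> \<phi> x = \<psi> x"
  shows "L \<phi> = L \<psi>"
proof -
  obtain C where C: "\<And>\<phi> B. \<phi> \<in> borel_measurable borel \<Longrightarrow> (\<And>x. x \<in> K \<Longrightarrow> norm (\<phi> x) \<le> B) \<Longrightarrow> 0 \<le> B \<Longrightarrow> norm (L \<phi>) \<le> C * B"
    using L_bound by blast
  have "norm (L (\<lambda>x. \<phi> x - \<psi> x)) \<le> C * 0"
    using assms by (intro C) (auto simp: admissible_def)
  then show ?thesis using assms by (simp add: L_minus)
qed

text \<open>This is the Jordan decomposition read backwards. It converts vanishing integrals into
  vanishing values of \<open>\<nu>\<close>.\<close>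

lemma L_indicator:
  assumes "E \<in> sets borel"
  shows "L (indicator E) = \<nu> E"
proof -
  have "complex_of_real (measure P E) = integral\<^sup>L P (indicator E :: complex \<Rightarrow> complex)" if "P \<in> parts" for P
  proof -
    interpret finite_measure P using that by (rule finite_measure_parts)
    have "integral\<^sup>L P (\<lambda>x. complex_of_real (indicator E x)) = complex_of_real (integral\<^sup>L P (indicator E))"
      by (rule integral_complex_of_real)
    also have "integral\<^sup>L P (indicator E :: complex \<Rightarrow> real) = measure P E"
      using assms that sets_parts sets_eq_imp_space_eq[OF sets_parts] by simp
    also have "(\<lambda>x. complex_of_real (indicator E x)) = indicator E" by (auto simp: indicator_def)
    finally show ?thesis by simp
  qed
  then have "L (indicator E) = complex_of_real (Re (\<nu> E)) + \<i> * complex_of_real (Im (\<nu> E))"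
    unfolding Re.Jordan_decomposition[OF assms] Im.Jordan_decomposition[OF assms]
    by (simp add: L_def parts_def)
  then show ?thesis by (simp add: complex_eq[symmetric])
qed

lemma L_dominated_convergence:
  assumes meas: "\<And>n. \<phi> n \<in> borel_measurable borel" "\<psi> \<in> borel_measurable borel"
    and lim: "\<And>x. (\<lambda>n. \<phi> n x) \<longlonglongrightarrow> \<psi> x" and bound: "\<And>n x. norm (\<phi> n x) \<le> B"
  shows "(\<lambda>n. L (\<phi> n)) \<longlonglongrightarrow> L \<psi>"
proof -
  have "(\<lambda>n. integral\<^sup>L P (\<phi> n)) \<longlonglongrightarrow> integral\<^sup>L P \<psi>" if P: "P \<in> parts" for P
  proof (rule integral_dominated_convergence[where w = "\<lambda>_. B"])
    interpret finite_measure P using P by (rule finite_measure_parts)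
    show "integrable P (\<lambda>_. B)" by simp
    have "measurable P borel = measurable borel (borel :: complex measure)"
      by (rule measurable_cong_sets[OF sets_parts[OF P] refl])
    then show "\<psi> \<in> borel_measurable P" "\<phi> n \<in> borel_measurable P" for n using meas by simp_all
  qed (use lim bound in auto)
  then show ?thesis
    unfolding L_def by (intro tendsto_intros) (simp_all add: parts_def)
qed

end

section \<open>A Muentz theorem for moment sequences\<close>

text \<open>
  Von Golitschek's step: if \<open>Q\<close> solves \<open>x Q' - a Q = -(a - 1) P\<close> with \<open>Q R = 0\<close>, then at an
  extremal point of \<open>Q\<close> the derivative term vanishes.
\<close>

lemma golitschek_bound:
  fixes P Q :: "real poly"
  assumes "1 < a" "0 < R"
    and ode: "\<And>x. x * poly (pderiv Q) x - a * poly Q x = - (a - 1) * poly P x"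
    and "poly Q R = 0"
    and P: "\<And>x. x \<in> {0..R} \<Longrightarrow> \<bar>poly P x\<bar> \<le> B"
    and "x \<in> {0..R}"
  shows "\<bar>poly Q x\<bar> \<le> (1 - 1 / a) * B"
proof -
  have "continuous_on {0..R} (\<lambda>x. \<bar>poly Q x\<bar>)" by (intro continuous_intros)
  then obtain x0 where x0: "x0 \<in> {0..R}" and max: "\<And>y. y \<in> {0..R} \<Longrightarrow> \<bar>poly Q y\<bar> \<le> \<bar>poly Q x0\<bar>"
    using continuous_attains_sup[of "{0..R}" "\<lambda>x. \<bar>poly Q x\<bar>"] \<open>0 < R\<close> by auto
  have "0 \<le> B" using P[OF x0] by linarith
  have "\<bar>poly Q x0\<bar> \<le> (1 - 1 / a) * B"
  proof (cases "x0 = R")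
    case True
    then show ?thesis using assms(1,4) \<open>0 \<le> B\<close> by simp
  next
    case False
    \<comment> \<open>At \<open>x0 = 0\<close> the factor kills the term, at an interior maximum of
      \<open>|Q|\<close> the derivative does.\<close>
    have "x0 * poly (pderiv Q) x0 = 0"
    proof (cases "x0 = 0")
      case False
      define d where "d = min x0 (R - x0)"
      have d: "0 < d" using False \<open>x0 \<noteq> R\<close> x0 by (auto simp: d_def)
      have near: "\<bar>poly Q y\<bar> \<le> \<bar>poly Q x0\<bar>" if "\<bar>x0 - y\<bar> < d" for y
        using that by (intro max) (auto simp: d_def)
      have "poly (pderiv Q) x0 = 0"
      proof (cases "0 \<le> poly Q x0")
        case True
        then have "\<forall>y. \<bar>x0 - y\<bar> < d \<longrightarrow> poly Q y \<le> poly Q x0" using near by fastforce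
        then show ?thesis by (rule DERIV_local_max[OF poly_DERIV d])
      next
        case False
        then have "\<forall>y. \<bar>x0 - y\<bar> < d \<longrightarrow> poly Q x0 \<le> poly Q y" using near by fastforce
        then show ?thesis by (rule DERIV_local_min[OF poly_DERIV d])
      qed
      then show ?thesis by simp
    qed simp
    with ode[of x0] have "poly Q x0 = (a - 1) / a * poly P x0" using assms(1) by (simp add: field_simps)
    then have "\<bar>poly Q x0\<bar> = (a - 1) / a * \<bar>poly P x0\<bar>" using assms(1) by (simp add: abs_mult)
    also have "\<dots> \<le> (a - 1) / a * B" using P[OF x0] assms(1) by (intro mult_left_mono) auto
    finally show ?thesis using assms(1) by (simp add: diff_divide_distrib)
  qed
  with max[OF assms(6)] show ?thesis by linarith
qed

text \<open>On coefficients the equation reads \<open>(l - n) q_l = - (n - 1) p_l\<close>. It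
  determines \<open>q_l\<close> for \<open>l \<noteq> n\<close>; at \<open>l = n\<close> both sides
  are \<open>0\<close>, so \<open>q_n\<close> is free and is spent on \<open>poly Q R = 0\<close>.
  The right side is scaled so that the coefficient at \<open>l = 1\<close> is unchanged.\<close>

lemma golitschek_step:
  fixes P :: "real poly" and n :: nat
  assumes "1 < n" "0 < R" "coeff P n = 0"
  obtains Q :: "real poly" where
    "\<And>l. l \<noteq> n \<Longrightarrow> coeff Q l = coeff P l * (real n - 1) / (real n - real l)"
    "poly Q R = 0"
    "\<And>x. x * poly (pderiv Q) x - real n * poly Q x = - (real n - 1) * poly P x"
proof -
  define Q0 where "Q0 = (\<Sum>l\<le>degree P. monom (coeff P l * (real n - 1) / (real n - real l)) l)"
  define Q where "Q = Q0 - monom (poly Q0 R / R ^ n) n"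
  have Q0: "coeff Q0 l = coeff P l * (real n - 1) / (real n - real l)" for l
    by (cases "l \<le> degree P") (auto simp: Q0_def coeff_sum coeff_eq_0)
  have Q: "coeff Q l = coeff P l * (real n - 1) / (real n - real l)" if "l \<noteq> n" for l
    using that by (simp add: Q_def Q0)
  have "pCons 0 (pderiv Q) - Polynomial.smult (real n) Q = Polynomial.smult (- (real n - 1)) P"
  proof (rule poly_eqI)
    fix l
    have "coeff (pCons 0 (pderiv Q)) l = real l * coeff Q l"
      by (cases l) (simp_all add: coeff_pderiv)
    moreover have "(real l - real n) * coeff Q l = - (real n - 1) * coeff P l"
      by (cases "l = n") (use assms(3) in \<open>simp_all add: Q field_simps\<close>)
    ultimately show "coeff (pCons 0 (pderiv Q) - Polynomial.smult (real n) Q) l = coeff (Polynomial.smult (- (real n - 1)) P) l"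
      by (simp add: algebra_simps)
  qed
  then have "poly (pCons 0 (pderiv Q) - Polynomial.smult (real n) Q) x = poly (Polynomial.smult (- (real n - 1)) P) x" for x
    by simp
  then have "x * poly (pderiv Q) x - real n * poly Q x = - (real n - 1) * poly P x" for x
    by simp
  moreover have "poly Q R = 0" using assms(2) by (simp add: Q_def poly_monom)
  ultimately show thesis using Q by (intro that[of Q])
qed

text \<open>Start from the monomial \<open>x\<close>, which is at most \<open>R\<close>. Each
  exponent \<open>n\<close> in \<open>F\<close> admits the monomial \<open>x ^ n\<close> and gains
  the factor \<open>1 - 1 / n\<close>, while the coefficient of \<open>x\<close> stays
  \<open>1\<close>. Thus \<open>x\<close> is approximated by powers with exponents in
  \<open>F\<close>, with an explicit error.\<close>

lemma muntz_poly:
  assumes "finite F" "F \<subseteq> {2..}" "0 < R"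
  shows "\<exists>Q :: real poly. coeff Q 1 = 1 \<and> (\<forall>l. coeff Q l \<noteq> 0 \<longrightarrow> l = 1 \<or> l \<in> F) \<and>
    (\<forall>x \<in> {0..R}. \<bar>poly Q x\<bar> \<le> R * (\<Prod>n\<in>F. 1 - 1 / real n))"
  using assms
proof (induction F)
  case empty
  show ?case
    by (rule exI[of _ "monom 1 1"]) (auto simp: poly_monom)
next
  case (insert n F)
  then obtain P :: "real poly" where P: "coeff P 1 = 1" "\<And>l. coeff P l \<noteq> 0 \<Longrightarrow> l = 1 \<or> l \<in> F"
    "\<And>x. x \<in> {0..R} \<Longrightarrow> \<bar>poly P x\<bar> \<le> R * (\<Prod>n\<in>F. 1 - 1 / real n)"
    by auto
  have n: "1 < n" using insert.prems by auto
  have "coeff P n = 0" using P(2)[of n] insert.hyps n by auto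
  then obtain Q where Q: "\<And>l. l \<noteq> n \<Longrightarrow> coeff Q l = coeff P l * (real n - 1) / (real n - real l)"
    "poly Q R = 0" "\<And>x. x * poly (pderiv Q) x - real n * poly Q x = - (real n - 1) * poly P x"
    using golitschek_step[OF n \<open>0 < R\<close>, of P] by metis
  have "\<bar>poly Q x\<bar> \<le> (1 - 1 / real n) * (R * (\<Prod>n\<in>F. 1 - 1 / real n))" if "x \<in> {0..R}" for x
    using n \<open>0 < R\<close> Q(3,2) P(3) that by (intro golitschek_bound[of _ R Q P]) auto
  moreover have "coeff Q 1 = 1" using Q(1)[of 1] P(1) n by simp
  moreover have "l = 1 \<or> l \<in> insert n F" if "coeff Q l \<noteq> 0" for l
    using that Q(1)[of l] P(2)[of l] by (cases "l = n") auto
  ultimately show ?case using insert.hyps by (intro exI[of _ Q]) (auto simp: algebra_simps)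
qed

section \<open>Moment sequences on a bounded interval\<close>

text \<open>
  Up to the unspecified constant \<open>C\<close>, this says that \<open>G\<close> is the moment sequence of a complex
  measure on \<open>[0, R]\<close>, phrased so that products need no product measure.
\<close>

definition tame :: "(nat \<Rightarrow> complex) \<Rightarrow> bool" where
  "tame G \<longleftrightarrow> (\<exists>C R. 0 \<le> C \<and> 0 < R \<and> (\<forall>n c B.
     (\<forall>x \<in> {0..R}. norm (\<Sum>l\<le>n. c l * complex_of_real x ^ l) \<le> B) \<longrightarrow> norm (\<Sum>l\<le>n. c l * G l) \<le> C * B))"

lemma tameI:
  assumes "0 \<le> C" "0 < R"
    "\<And>n c B. (\<And>x. x \<in> {0..R} \<Longrightarrow> norm (\<Sum>l\<le>n. c l * complex_of_real x ^ l) \<le> B) \<Longrightarrow>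
       norm (\<Sum>l\<le>n. c l * G l) \<le> C * B"
  shows "tame G"
  unfolding tame_def using assms by blast

text \<open>These are the moments of \<open>a\<close> times the unit mass at
  \<open>1\<close>.\<close>

lemma tame_const: "tame (\<lambda>_. a)"
proof (rule tameI[of "norm a" 1])
  fix n c B
  assume "\<And>x. x \<in> {0..1} \<Longrightarrow> norm (\<Sum>l\<le>n. c l * complex_of_real x ^ l) \<le> B"
  from this[of 1] have "norm (\<Sum>l\<le>n. c l) \<le> B" by simp
  then show "norm (\<Sum>l\<le>n. c l * a) \<le> norm a * B"
    by (simp add: sum_distrib_right[symmetric] norm_mult mult.commute[of _ "norm a"] mult_left_mono)
qed auto

lemma tame_add:
  assumes "tame F" "tame G"
  shows "tame (\<lambda>l. F l + G l)"
proof -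
  obtain C R where F: "0 \<le> C" "0 < R"
    "\<And>n c B. (\<forall>x \<in> {0..R}. norm (\<Sum>l\<le>n. c l * complex_of_real x ^ l) \<le> B) \<Longrightarrow> norm (\<Sum>l\<le>n. c l * F l) \<le> C * B"
    using assms(1) unfolding tame_def by metis
  obtain C' R' where G: "0 \<le> C'" "0 < R'"
    "\<And>n c B. (\<forall>x \<in> {0..R'}. norm (\<Sum>l\<le>n. c l * complex_of_real x ^ l) \<le> B) \<Longrightarrow> norm (\<Sum>l\<le>n. c l * G l) \<le> C' * B"
    using assms(2) unfolding tame_def by metis
  show ?thesis
  proof (rule tameI[of "C + C'" "max R R'"])
    fix n c B
    assume *: "\<And>x. x \<in> {0..max R R'} \<Longrightarrow> norm (\<Sum>l\<le>n. c l * complex_of_real x ^ l) \<le> B"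
    have "norm (\<Sum>l\<le>n. c l * F l) \<le> C * B" "norm (\<Sum>l\<le>n. c l * G l) \<le> C' * B"
      using * by (auto intro!: F(3) G(3))
    then show "norm (\<Sum>l\<le>n. c l * (F l + G l)) \<le> (C + C') * B"
      using norm_triangle_ineq[of "\<Sum>l\<le>n. c l * F l" "\<Sum>l\<le>n. c l * G l"]
      by (simp add: distrib_left distrib_right sum.distrib)
  qed (use F G in auto)
qed

text \<open>For fixed \<open>y\<close> in \<open>[0, R']\<close> the bound for \<open>F\<close> is
  applied to the polynomial \<open>p (x y)\<close> in \<open>x\<close>; the result is a polynomial
  in \<open>y\<close>, to which the bound for \<open>G\<close> applies. The arguments
  \<open>x y\<close> fill \<open>[0, R R']\<close>.\<close>

lemma tame_mult:
  assumes "tame F" "tame G"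
  shows "tame (\<lambda>l. F l * G l)"
proof -
  obtain C R where F: "0 \<le> C" "0 < R"
    "\<And>n c B. (\<forall>x \<in> {0..R}. norm (\<Sum>l\<le>n. c l * complex_of_real x ^ l) \<le> B) \<Longrightarrow> norm (\<Sum>l\<le>n. c l * F l) \<le> C * B"
    using assms(1) unfolding tame_def by metis
  obtain C' R' where G: "0 \<le> C'" "0 < R'"
    "\<And>n c B. (\<forall>x \<in> {0..R'}. norm (\<Sum>l\<le>n. c l * complex_of_real x ^ l) \<le> B) \<Longrightarrow> norm (\<Sum>l\<le>n. c l * G l) \<le> C' * B"
    using assms(2) unfolding tame_def by metis
  show ?thesis
  proof (rule tameI[of "C' * C" "R * R'"])
    fix n c B
    assume *: "\<And>x. x \<in> {0..R * R'} \<Longrightarrow> norm (\<Sum>l\<le>n. c l * complex_of_real x ^ l) \<le> B"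
    have "norm (\<Sum>l\<le>n. (c l * F l) * complex_of_real y ^ l) \<le> C * B" if y: "y \<in> {0..R'}" for y
    proof -
      have "norm (\<Sum>l\<le>n. (c l * complex_of_real y ^ l) * F l) \<le> C * B"
      proof (rule F(3), intro ballI)
        fix x assume "x \<in> {0..R}"
        then have "x * y \<in> {0..R * R'}" using y by (auto intro: mult_mono)
        from *[OF this] show "norm (\<Sum>l\<le>n. c l * complex_of_real y ^ l * complex_of_real x ^ l) \<le> B"
          by (simp add: power_mult_distrib ac_simps)
      qed
      then show ?thesis by (simp add: ac_simps)
    qed
    then have "norm (\<Sum>l\<le>n. (c l * F l) * G l) \<le> C' * (C * B)" by (intro G(3)) auto
    then show "norm (\<Sum>l\<le>n. c l * (F l * G l)) \<le> C' * C * B" by (simp add: ac_simps)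
  qed (use F G in auto)
qed

lemma tame_sum: "(\<And>i. i \<in> I \<Longrightarrow> tame (G i)) \<Longrightarrow> tame (\<lambda>l. \<Sum>i\<in>I. G i l)"
  by (induction I rule: infinite_finite_induct) (auto intro: tame_const tame_add)

lemma tame_prod: "(\<And>i. i \<in> I \<Longrightarrow> tame (G i)) \<Longrightarrow> tame (\<lambda>l. \<Prod>i\<in>I. G i l)"
  by (induction I rule: infinite_finite_induct) (auto intro: tame_const tame_mult)

text \<open>The harmonic series still diverges after removal of the summable part \<open>A\<close>,
  and \<open>1 - x <= exp (- x)\<close> turns a large sum into a small product.\<close>

lemma small_muntz_product:
  fixes \<epsilon> :: real
  assumes A: "(\<lambda>s. 1 / (real s + 1)) summable_on A" and "0 < \<epsilon>"
  obtains F where "finite F" "F \<subseteq> {2..} - A" "(\<Prod>n\<in>F. 1 - 1 / real n) < \<epsilon>"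
proof -
  have "\<exists>F. finite F \<and> F \<subseteq> {2..} - A \<and> (\<Sum>n\<in>F. 1 / real n) > - ln \<epsilon>"
  proof (rule ccontr)
    assume "\<nexists>F. finite F \<and> F \<subseteq> {2..} - A \<and> (\<Sum>n\<in>F. 1 / real n) > - ln \<epsilon>"
    then have "bdd_above (sum (\<lambda>n. 1 / real n) ` {F. F \<subseteq> {2..} - A \<and> finite F})"
      by (intro bdd_aboveI[of _ "- ln \<epsilon>"]) (auto simp: not_less)
    then have "(\<lambda>n. 1 / real n) summable_on ({2..} - A)"
      by (intro nonneg_bdd_above_summable_on) auto
    then have "(\<lambda>s. 1 / (real s + 1)) summable_on ({2..} - A)"
      by (rule summable_on_comparison_test) (auto intro!: divide_left_mono)
    moreover have "(\<lambda>s. 1 / (real s + 1)) summable_on (A \<union> {0, 1})"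
      by (intro summable_on_union A summable_on_finite) auto
    ultimately have "(\<lambda>s. 1 / (real s + 1)) summable_on (({2..} - A) \<union> (A \<union> {0, 1}))"
      by (rule summable_on_union)
    moreover have "({2..} - A) \<union> (A \<union> {0, 1}) = UNIV"
    proof -
      have "n = 0 \<or> n = 1 \<or> 2 \<le> n" for n :: nat by linarith
      then show ?thesis by auto
    qed
    ultimately have "summable (\<lambda>s. 1 / (real s + 1))"
      by (simp add: summable_on_UNIV_nonneg_real_iff)
    then have "summable (\<lambda>s. 1 / real (Suc s))" by (simp add: add.commute)
    then show False
      using not_summable_harmonic[where 'a = real] summable_Suc_iff[of "\<lambda>n. inverse (real n)"]
      by (simp add: inverse_eq_divide)
  qed
  then obtain F where F: "finite F" "F \<subseteq> {2..} - A" "(\<Sum>n\<in>F. 1 / real n) > - ln \<epsilon>" by blast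
  have "(\<Prod>n\<in>F. 1 - 1 / real n) \<le> (\<Prod>n\<in>F. exp (- (1 / real n)))"
  proof (rule prod_mono)
    fix n assume "n \<in> F"
    then have "2 \<le> n" using F(2) by auto
    then show "0 \<le> 1 - 1 / real n \<and> 1 - 1 / real n \<le> exp (- (1 / real n))"
      using exp_ge_add_one_self[of "- (1 / real n)"] by auto
  qed
  also have "\<dots> = exp (- (\<Sum>n\<in>F. 1 / real n))" using F(1) by (simp add: exp_sum sum_negf[symmetric])
  also have "\<dots> < exp (ln \<epsilon>)" using F(3) by simp
  finally show thesis using F that \<open>0 < \<epsilon>\<close> by simp
qed

text \<open>Tested on the polynomial of \<open>muntz_poly\<close> with exponents outside
  \<open>A\<close>, the sequence yields exactly \<open>G 1\<close>, since \<open>G\<close> vanishes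
  at the other exponents. Those polynomials can be made uniformly small on
  \<open>[0, R]\<close>.\<close>

lemma tame_eq_0:
  assumes "tame G" and A: "(\<lambda>s. 1 / (real s + 1)) summable_on A" and zero: "\<And>l. l \<notin> A \<Longrightarrow> G l = 0"
  shows "G 1 = 0"
proof (rule ccontr)
  assume "G 1 \<noteq> 0"
  obtain C R where C: "0 \<le> C" "0 < R"
    and bound: "\<And>n c B. (\<forall>x \<in> {0..R}. norm (\<Sum>l\<le>n. c l * complex_of_real x ^ l) \<le> B) \<Longrightarrow> norm (\<Sum>l\<le>n. c l * G l) \<le> C * B"
    using assms(1) unfolding tame_def by metis
  \<comment> \<open>The factor \<open>C + 1\<close> in place of \<open>C\<close> leaves room for a
    strict inequality and permits \<open>C = 0\<close>.\<close>
  define \<epsilon> where "\<epsilon> = norm (G 1) / ((C + 1) * R)"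
  have "0 < \<epsilon>" using \<open>G 1 \<noteq> 0\<close> C by (simp add: \<epsilon>_def)
  then obtain F where F: "finite F" "F \<subseteq> {2..} - A" "(\<Prod>n\<in>F. 1 - 1 / real n) < \<epsilon>"
    using small_muntz_product[OF A] by metis
  have "F \<subseteq> {2..}" using F(2) by blast
  from muntz_poly[OF F(1) this C(2)] obtain Q :: "real poly" where Q: "coeff Q 1 = 1"
    "\<And>l. coeff Q l \<noteq> 0 \<Longrightarrow> l = 1 \<or> l \<in> F"
    "\<And>x. x \<in> {0..R} \<Longrightarrow> \<bar>poly Q x\<bar> \<le> R * (\<Prod>n\<in>F. 1 - 1 / real n)" by auto
  have "(\<Sum>l\<le>degree Q. complex_of_real (coeff Q l) * complex_of_real x ^ l) = complex_of_real (poly Q x)" for x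
    by (simp add: poly_altdef)
  then have "norm (\<Sum>l\<le>degree Q. complex_of_real (coeff Q l) * G l) \<le> C * (R * (\<Prod>n\<in>F. 1 - 1 / real n))"
    using Q(3) by (intro bound) simp
  moreover have "(\<Sum>l\<le>degree Q. complex_of_real (coeff Q l) * G l) = G 1"
  proof -
    have "1 \<le> degree Q" using Q(1) by (intro le_degree) simp
    moreover have "complex_of_real (coeff Q l) * G l = 0" if "l \<noteq> 1" for l
      using that Q(2)[of l] zero[of l] F(2) by auto
    ultimately have "(\<Sum>l\<le>degree Q. complex_of_real (coeff Q l) * G l) = (\<Sum>l\<in>{1}. complex_of_real (coeff Q l) * G l)"
      by (intro sum.mono_neutral_right) auto
    then show ?thesis using Q(1) by simp
  qed
  ultimately have "norm (G 1) \<le> C * R * (\<Prod>n\<in>F. 1 - 1 / real n)" by (simp add: ac_simps)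
  also have "\<dots> \<le> C * R * \<epsilon>" using F(3) C by (intro mult_left_mono) auto
  also have "\<dots> < (C + 1) * R * \<epsilon>" using C \<open>0 < \<epsilon>\<close> by simp
  also have "\<dots> = norm (G 1)" using C by (simp add: \<epsilon>_def)
  finally show False by simp
qed

lemma summable_on_shift:
  assumes "(\<lambda>s. 1 / (real s + 1)) summable_on S"
  shows "(\<lambda>s. 1 / (real s + 1)) summable_on {l. m + l \<in> S}"
proof -
  have "(\<lambda>s. 1 / (real s + 1)) summable_on ((+) m ` {l. m + l \<in> S})"
    using assms by (rule summable_on_subset_banach) auto
  then have "(\<lambda>l. 1 / (real (m + l) + 1)) summable_on {l. m + l \<in> S}"
    by (subst (asm) summable_on_reindex) (auto simp: o_def)
  \<comment> \<open>The factor \<open>m + 1\<close> serves the comparison, because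
    \<open>m + l + 1 <= (m + 1) (l + 1)\<close>.\<close>
  then have "(\<lambda>l. (real m + 1) * (1 / (real (m + l) + 1))) summable_on {l. m + l \<in> S}"
    by (rule summable_on_cmult_right)
  then show ?thesis
    by (rule summable_on_comparison_test) (auto simp: field_simps)
qed

section \<open>Determinants of finite arrays\<close>

lemma permutes_less: "p permutes {0..<n} \<Longrightarrow> i < n \<Longrightarrow> p i < (n :: nat)"
  using permutes_in_image[of p "{0..<n}" i] by simp

text \<open>Arrays indexed by all naturals need no dimension side conditions: rows are replaced by
  function update, and minors arise by composing with index functions.\<close>

definition arr_det :: "nat \<Rightarrow> (nat \<Rightarrow> nat \<Rightarrow> complex) \<Rightarrow> complex" where
  "arr_det n F = Determinant.det (Matrix.mat n n (\<lambda>(i, j). F i j))"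

lemma arr_det_expand:
  "arr_det n F = (\<Sum>p | p permutes {0..<n}. signof p * (\<Prod>i = 0..<n. F i (p i)))"
proof -
  have "arr_det n F = (\<Sum>p | p permutes {0..<n}. signof p * (\<Prod>i = 0..<n. Matrix.mat n n (\<lambda>(i, j). F i j) $$ (i, p i)))"
    unfolding arr_det_def by (rule det_def') simp
  also have "\<dots> = (\<Sum>p | p permutes {0..<n}. signof p * (\<Prod>i = 0..<n. F i (p i)))"
    by (intro sum.cong refl arg_cong2[of _ _ _ _ "(*)"] prod.cong) (auto simp: permutes_less)
  finally show ?thesis .
qed

lemma arr_det_0 [simp]: "arr_det 0 F = 1"
  by (simp add: arr_det_expand)

lemma arr_det_cong:
  assumes "\<And>i j. i < n \<Longrightarrow> j < n \<Longrightarrow> F i j = G i j"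
  shows "arr_det n F = arr_det n G"
  unfolding arr_det_def using assms by (intro arg_cong[of _ _ Determinant.det] eq_matI) auto

lemma arr_det_mult: "arr_det n (\<lambda>i j. \<Sum>t<n. F i t * G t j) = arr_det n F * arr_det n G"
proof -
  have "Matrix.mat n n (\<lambda>(i, j). \<Sum>t<n. F i t * G t j) = Matrix.mat n n (\<lambda>(i, j). F i j) * Matrix.mat n n (\<lambda>(i, j). G i j)"
    by (intro eq_matI) (auto simp: scalar_prod_def lessThan_atLeast0)
  then show ?thesis unfolding arr_det_def by (simp add: Determinant.det_mult[of _ n])
qed

lemma arr_det_zero_row:
  assumes "k < n" "\<And>j. j < n \<Longrightarrow> F k j = 0"
  shows "arr_det n F = 0"
  unfolding arr_det_expand
proof (intro sum.neutral ballI)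
  fix p assume "p \<in> {p. p permutes {0..<n}}"
  then have "F k (p k) = 0" using assms by (auto simp: permutes_less)
  then have "(\<Prod>i = 0..<n. F i (p i)) = 0" using assms(1) by (intro prod_zero) auto
  then show "signof p * (\<Prod>i = 0..<n. F i (p i)) = 0" by simp
qed

lemma arr_det_kernel:
  assumes "arr_det n F = 0"
  obtains v j where "j < n" "v j \<noteq> 0" "\<And>i. i < n \<Longrightarrow> (\<Sum>j<n. F i j * v j) = 0"
proof -
  let ?A = "Matrix.mat n n (\<lambda>(i, j). F i j)"
  obtain v where v: "v \<in> carrier_vec n" "v \<noteq> 0\<^sub>v n" "?A *\<^sub>v v = 0\<^sub>v n"
    using assms det_0_iff_vec_prod_zero_field[of ?A n] unfolding arr_det_def by auto
  obtain j where "j < n" "vec_index v j \<noteq> 0" using v(1,2) by (auto simp: vec_eq_iff)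
  moreover have "(\<Sum>j<n. F i j * vec_index v j) = 0" if "i < n" for i
  proof -
    have "vec_index (?A *\<^sub>v v) i = 0" using v(3) that by simp
    then show ?thesis using v(1) that by (simp add: scalar_prod_def lessThan_atLeast0)
  qed
  ultimately show thesis using that by blast
qed

lemma arr_det_left_inverse:
  assumes "arr_det n F \<noteq> 0"
  obtains C where "\<And>i j. i < n \<Longrightarrow> j < n \<Longrightarrow> (\<Sum>t<n. C i t * F t j) = (if i = j then 1 else 0)"
proof -
  let ?A = "Matrix.mat n n (\<lambda>(i, j). F i j)"
  let ?B = "adj_mat ?A"
  have A: "?A \<in> carrier_mat n n" by simp
  have "(\<Sum>t<n. ?B $$ (i, t) / arr_det n F * F t j) = (if i = j then 1 else 0)" if ij: "i < n" "j < n" for i j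
  proof -
    have "(\<Sum>t<n. ?B $$ (i, t) * F t j) = (?B * ?A) $$ (i, j)"
      using ij adj_mat(1)[OF A] by (simp add: scalar_prod_def lessThan_atLeast0)
    also have "\<dots> = (if i = j then arr_det n F else 0)"
      using adj_mat(3)[OF A] ij by (simp add: arr_det_def)
    finally show ?thesis using assms
      by (auto simp: sum_divide_distrib[symmetric] times_divide_eq_left)
  qed
  then show thesis by (rule that[of "\<lambda>i t. ?B $$ (i, t) / arr_det n F"])
qed

lemma arr_det_solve:
  assumes "arr_det n F \<noteq> 0"
  obtains x where "\<And>j. j < n \<Longrightarrow> b j = (\<Sum>i<n. x i * F i j)"
proof -
  obtain C where C: "\<And>i j. i < n \<Longrightarrow> j < n \<Longrightarrow> (\<Sum>t<n. C i t * F t j) = (if i = j then 1 else 0)"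
    using arr_det_left_inverse[OF assms] by metis
  have "b j = (\<Sum>i<n. (\<Sum>t<n. b t * C t i) * F i j)" if "j < n" for j
  proof -
    have "(\<Sum>i<n. (\<Sum>t<n. b t * C t i) * F i j) = (\<Sum>t<n. b t * (\<Sum>i<n. C t i * F i j))"
      unfolding sum_distrib_right sum_distrib_left by (subst sum.swap) (simp add: mult.assoc)
    also have "\<dots> = (\<Sum>t<n. if t = j then b t else 0)" using C that by (intro sum.cong) auto
    finally show ?thesis using that by simp
  qed
  then show thesis by (rule that)
qed

text \<open>Replacing row \<open>k\<close> by \<open>b\<close> is left multiplication by the
  identity matrix with \<open>k\<close>-th row \<open>x\<close>, whose determinant is
  \<open>x k\<close>.\<close>

lemma arr_det_cramer:
  assumes "k < n" and b: "\<And>j. j < n \<Longrightarrow> b j = (\<Sum>i<n. x i * F i j)"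
  shows "arr_det n (F(k := b)) = x k * arr_det n F"
proof -
  let ?P = "\<lambda>i t. if i = k then x t else if i = t then 1 else 0 :: complex"
  have "arr_det n (F(k := b)) = arr_det n (\<lambda>i j. \<Sum>t<n. ?P i t * F t j)"
  proof (rule arr_det_cong)
    fix i j assume ij: "i < n" "j < n"
    have "(\<Sum>t<n. (if i = t then 1 else 0) * F t j) = (\<Sum>t<n. if i = t then F t j else 0)"
      by (intro sum.cong) auto
    then show "(F(k := b)) i j = (\<Sum>t<n. ?P i t * F t j)"
      using ij b by (cases "i = k") auto
  qed
  also have "\<dots> = arr_det n ?P * arr_det n F" by (rule arr_det_mult)
  also have "arr_det n ?P = x k"
  proof -
    have "(\<Prod>i = 0..<n. ?P i (p i)) = (if p = id then x k else 0)" if p: "p permutes {0..<n}" for p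
    proof (cases "p = id")
      case True
      have "(\<Prod>i = 0..<n. ?P i (p i)) = (\<Prod>i = 0..<n. if i = k then x k else 1)"
        unfolding True by (intro prod.cong) auto
      then show ?thesis using True \<open>k < n\<close> by simp
    next
      case False
      \<comment> \<open>A permutation fixing every index except \<open>k\<close> also fixes
        \<open>k\<close> by injectivity, so any other permutation meets a zero off row
        \<open>k\<close>.\<close>
      have "\<exists>i<n. i \<noteq> k \<and> p i \<noteq> i"
      proof (rule ccontr)
        assume "\<not> ?thesis"
        then have fixed: "p i = i" if "i \<noteq> k" for i
          using that p by (cases "i < n") (auto simp: permutes_def)
        have "p k = k"
        proof (rule ccontr)
          assume "p k \<noteq> k"
          then have "p (p k) = p k" by (rule fixed)
          then show False using \<open>p k \<noteq> k\<close> permutes_inj[OF p] by (auto dest: injD)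
        qed
        with fixed have "p = id" by (metis eq_id_iff)
        with False show False ..
      qed
      then obtain i where i: "i < n" "i \<noteq> k" "p i \<noteq> i" by blast
      then have "(\<Prod>i = 0..<n. ?P i (p i)) = 0" by (intro prod_zero bexI[of _ i]) auto
      then show ?thesis using False by simp
    qed
    then have "arr_det n ?P = (\<Sum>p | p permutes {0..<n}. if p = id then x k else 0)"
      unfolding arr_det_expand by (intro sum.cong) auto
    also have "\<dots> = x k"
      by (subst sum.delta) (auto simp: finite_permutations permutes_id)
    finally show ?thesis .
  qed
  finally show ?thesis .
qed

text \<open>Padding with zeros factors \<open>F\<close> through square arrays, and the right factor
  has a zero row because \<open>card B < n\<close>.\<close>

lemma arr_det_low_rank:
  assumes "finite B" "card B < n"
    and F: "\<And>i j. i < n \<Longrightarrow> j < n \<Longrightarrow> F i j = (\<Sum>b\<in>B. u i b * v b j)"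
  shows "arr_det n F = 0"
proof -
  obtain e where e: "bij_betw e {0..<card B} B" using ex_bij_betw_nat_finite[OF assms(1)] by blast
  let ?U = "\<lambda>i t. if t < card B then u i (e t) else 0"
  let ?V = "\<lambda>t j. if t < card B then v (e t) j else 0"
  have "arr_det n F = arr_det n (\<lambda>i j. \<Sum>t<n. ?U i t * ?V t j)"
  proof (rule arr_det_cong)
    fix i j assume "i < n" "j < n"
    then have "F i j = (\<Sum>t\<in>{0..<card B}. u i (e t) * v (e t) j)"
      using F sum.reindex_bij_betw[OF e, of "\<lambda>b. u i b * v b j"] by simp
    also have "\<dots> = (\<Sum>t<n. ?U i t * ?V t j)"
      using assms(2) by (intro sum.mono_neutral_cong_left) auto
    finally show "F i j = (\<Sum>t<n. ?U i t * ?V t j)" .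
  qed
  also have "\<dots> = arr_det n ?U * arr_det n ?V" by (rule arr_det_mult)
  also have "arr_det n ?V = 0" using assms(2) by (intro arr_det_zero_row[of "card B"]) auto
  finally show ?thesis by simp
qed

lemma tame_arr_det:
  assumes "\<And>i j. tame (G i j)"
  shows "tame (\<lambda>l. arr_det n (\<lambda>i j. G i j l))"
  unfolding arr_det_expand by (intro tame_sum tame_mult tame_prod tame_const assms)

lemma holomorphic_on_arr_det:
  assumes "\<And>i j. (\<lambda>a. G a i j) holomorphic_on A"
  shows "(\<lambda>a. arr_det n (G a)) holomorphic_on A"
  unfolding arr_det_expand by (intro holomorphic_intros assms)

lemma cnj_arr_det: "cnj (arr_det n F) = arr_det n (\<lambda>i j. cnj (F i j))"
  unfolding arr_det_expand by (simp add: sign_def)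

lemma norm_arr_det_le:
  assumes "\<And>i j. i < n \<Longrightarrow> j < n \<Longrightarrow> norm (F i j) \<le> B"
  shows "norm (arr_det n F) \<le> fact n * B ^ n"
proof -
  have "norm (arr_det n F) \<le> (\<Sum>p | p permutes {0..<n}. norm (signof p * (\<Prod>i = 0..<n. F i (p i))))"
    unfolding arr_det_expand by (rule norm_sum)
  also have "\<dots> \<le> (\<Sum>p | p permutes {0..<n}. B ^ n)"
  proof (rule sum_mono)
    fix p assume "p \<in> {p. p permutes {0..<n}}"
    then have "(\<Prod>i = 0..<n. norm (F i (p i))) \<le> (\<Prod>i = 0..<n. B)"
      using assms by (intro prod_mono) (auto simp: permutes_less)
    then show "norm (signof p * (\<Prod>i = 0..<n. F i (p i))) \<le> B ^ n"
      by (simp add: norm_mult prod_norm sign_def)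
  qed
  also have "\<dots> = fact n * B ^ n" by (simp add: card_permutations[of "{0..<n}" n])
  finally show ?thesis .
qed

lemma bounded_arr_det:
  assumes "\<And>i j. \<exists>B. \<forall>a. norm (G a i j) \<le> B"
  shows "\<exists>B. \<forall>a. norm (arr_det n (G a)) \<le> B"
proof -
  obtain b where b: "\<And>i j a. norm (G a i j) \<le> b i j" using assms by metis
  have "b i j \<le> (\<Sum>i<n. \<Sum>j<n. b i j)" if "i < n" "j < n" for i j
  proof -
    have nonneg: "0 \<le> b i j" for i j using b[of undefined i j] norm_ge_zero order_trans by blast
    have "b i j \<le> (\<Sum>j<n. b i j)" using that nonneg by (intro member_le_sum) auto
    also have "\<dots> \<le> (\<Sum>i<n. \<Sum>j<n. b i j)"
      using that nonneg by (intro member_le_sum[of i _ "\<lambda>i. \<Sum>j<n. b i j"] sum_nonneg) auto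
    finally show ?thesis .
  qed
  then have "norm (arr_det n (G a)) \<le> fact n * (\<Sum>i<n. \<Sum>j<n. b i j) ^ n" for a
    using b by (intro norm_arr_det_le) (meson order_trans)
  then show ?thesis by blast
qed

text \<open>Border the invertible \<open>r\<close> by \<open>r\<close> block with row
  \<open>x\<close> and column \<open>y\<close>. A kernel vector of the singular bordered array has
  nonzero last entry, and eliminating its other entries expresses \<open>a x y\<close>;
  \<open>C\<close> is the inverse of the block.\<close>

lemma rank_factorization:
  fixes a :: "nat \<Rightarrow> nat \<Rightarrow> complex"
  assumes nz: "arr_det r (\<lambda>i j. a (m i) (k j)) \<noteq> 0"
    and zero: "\<And>m k. arr_det (Suc r) (\<lambda>i j. a (m i) (k j)) = 0"
  obtains C where "\<And>x y. a x y = (\<Sum>j<r. \<Sum>i<r. a x (k j) * C j i * a (m i) y)"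
proof -
  obtain C where C: "\<And>i j. i < r \<Longrightarrow> j < r \<Longrightarrow> (\<Sum>t<r. C i t * a (m t) (k j)) = (if i = j then 1 else 0)"
    using arr_det_left_inverse[OF nz] by metis
  have left_inv: "w j = (\<Sum>i<r. C j i * (\<Sum>t<r. a (m i) (k t) * w t))" if "j < r" for w :: "nat \<Rightarrow> complex" and j
  proof -
    have "(\<Sum>i<r. C j i * (\<Sum>t<r. a (m i) (k t) * w t)) = (\<Sum>t<r. (\<Sum>i<r. C j i * a (m i) (k t)) * w t)"
      unfolding sum_distrib_left sum_distrib_right by (subst sum.swap) (simp add: mult.assoc)
    also have "\<dots> = (\<Sum>t<r. if j = t then w t else 0)" using C that by (intro sum.cong) auto
    finally show ?thesis using that by simp
  qed
  have "a x y = (\<Sum>j<r. \<Sum>i<r. a x (k j) * C j i * a (m i) y)" for x y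
  proof -
    obtain v s where s: "s < Suc r" "v s \<noteq> 0"
      and v: "\<And>i. i < Suc r \<Longrightarrow> (\<Sum>j<Suc r. a ((m(r := x)) i) ((k(r := y)) j) * v j) = 0"
      using arr_det_kernel[OF zero[of "m(r := x)" "k(r := y)"]] by metis
    have rows: "(\<Sum>j<r. a (m i) (k j) * v j) = - (a (m i) y * v r)" if "i < r" for i
      using v[of i] that by (simp add: eq_neg_iff_add_eq_0)
    have row_x: "(\<Sum>j<r. a x (k j) * v j) = - (a x y * v r)"
      using v[of r] by (simp add: eq_neg_iff_add_eq_0)
    have "v r \<noteq> 0"
    proof
      assume "v r = 0"
      have "v j = 0" if "j < r" for j
        using left_inv[OF that, of v] rows \<open>v r = 0\<close> by simp
      then show False using s \<open>v r = 0\<close> by (auto simp: less_Suc_eq)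
    qed
    have vj: "v j = - (v r * (\<Sum>i<r. C j i * a (m i) y))" if "j < r" for j
    proof -
      have "v j = (\<Sum>i<r. C j i * (\<Sum>t<r. a (m i) (k t) * v t))" by (rule left_inv[OF that])
      also have "\<dots> = (\<Sum>i<r. C j i * - (a (m i) y * v r))" using rows by (intro sum.cong) auto
      also have "\<dots> = - (v r * (\<Sum>i<r. C j i * a (m i) y))"
        by (simp add: sum_distrib_left sum_negf ac_simps)
      finally show ?thesis .
    qed
    have "a x y * v r = - (\<Sum>j<r. a x (k j) * v j)" using row_x by simp
    also have "\<dots> = (\<Sum>j<r. a x (k j) * (v r * (\<Sum>i<r. C j i * a (m i) y)))"
      by (simp add: vj sum_negf)
    also have "\<dots> = (\<Sum>j<r. \<Sum>i<r. a x (k j) * C j i * a (m i) y) * v r"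
      unfolding sum_distrib_left sum_distrib_right by (simp add: ac_simps)
    finally show ?thesis using \<open>v r \<noteq> 0\<close> by simp
  qed
  then show thesis by (rule that)
qed

section \<open>Functionals on continuous functions whose moment matrix has finite rank\<close>

text \<open>Only linearity and a sup bound on \<open>K\<close> are kept, so that weighted integrals
  and the conjugate functional are both instances.\<close>

locale compact_functional =
  fixes \<Lambda> :: "(complex \<Rightarrow> complex) \<Rightarrow> complex" and K :: "complex set" and C :: real
  assumes compact_K: "compact K" and C_nonneg: "0 \<le> C"
    and add: "continuous_on UNIV \<phi> \<Longrightarrow> continuous_on UNIV \<psi> \<Longrightarrow> \<Lambda> (\<lambda>z. \<phi> z + \<psi> z) = \<Lambda> \<phi> + \<Lambda> \<psi>"
    and cmult: "continuous_on UNIV \<phi> \<Longrightarrow> \<Lambda> (\<lambda>z. c * \<phi> z) = c * \<Lambda> \<phi>"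
    and bound: "continuous_on UNIV \<phi> \<Longrightarrow> (\<And>z. z \<in> K \<Longrightarrow> norm (\<phi> z) \<le> B) \<Longrightarrow> 0 \<le> B \<Longrightarrow> norm (\<Lambda> \<phi>) \<le> C * B"
begin

lemma zero: "\<Lambda> (\<lambda>_. 0) = 0"
  using cmult[of "\<lambda>_. 0" 0] by simp

lemma diff:
  assumes "continuous_on UNIV \<phi>" "continuous_on UNIV \<psi>"
  shows "\<Lambda> (\<lambda>z. \<phi> z - \<psi> z) = \<Lambda> \<phi> - \<Lambda> \<psi>"
  using add[of \<phi> "\<lambda>z. - 1 * \<psi> z"] cmult[of \<psi> "- 1"] assms by (simp add: continuous_on_minus)

lemma sum:
  assumes "\<And>i. i \<in> I \<Longrightarrow> continuous_on UNIV (\<phi> i)"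
  shows "\<Lambda> (\<lambda>z. \<Sum>i\<in>I. \<phi> i z) = (\<Sum>i\<in>I. \<Lambda> (\<phi> i))"
  using assms
  by (induction I rule: infinite_finite_induct) (auto simp: zero add continuous_on_sum)

lemma bounded_on_K:
  assumes "continuous_on UNIV (\<phi> :: complex \<Rightarrow> complex)"
  obtains B where "0 \<le> B" "\<And>z. z \<in> K \<Longrightarrow> norm (\<phi> z) \<le> B"
proof -
  have "continuous_on K \<phi>" using assms continuous_on_subset by blast
  then have "bounded (\<phi> ` K)" by (intro compact_imp_bounded compact_continuous_image compact_K)
  then obtain B where "\<And>z. z \<in> K \<Longrightarrow> norm (\<phi> z) \<le> B" by (auto simp: bounded_iff)
  then show thesis using that[of "max B 0"] by (meson max.coboundedI1 max.cobounded2)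
qed

lemma tendsto_of_uniform_limit:
  assumes "uniform_limit K \<phi> \<psi> sequentially" "\<And>n. continuous_on UNIV (\<phi> n)" "continuous_on UNIV \<psi>"
  shows "(\<lambda>n. \<Lambda> (\<phi> n)) \<longlonglongrightarrow> \<Lambda> \<psi>"
proof (rule tendstoI)
  fix e :: real assume "0 < e"
  then have "0 < e / (C + 1)" using C_nonneg by simp
  with assms(1) have "\<forall>\<^sub>F n in sequentially. \<forall>z\<in>K. dist (\<phi> n z) (\<psi> z) < e / (C + 1)"
    by (rule uniform_limitD)
  then show "\<forall>\<^sub>F n in sequentially. dist (\<Lambda> (\<phi> n)) (\<Lambda> \<psi>) < e"
  proof eventually_elim
    case (elim n)
    have "norm (\<Lambda> (\<lambda>z. \<phi> n z - \<psi> z)) \<le> C * (e / (C + 1))"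
      using elim assms(2,3) \<open>0 < e / (C + 1)\<close>
      by (intro bound continuous_on_diff) (auto simp: dist_norm intro: less_imp_le)
    also have "\<dots> < e" using C_nonneg \<open>0 < e\<close> by (simp add: field_simps)
    finally show ?case by (simp add: diff assms dist_norm)
  qed
qed

text \<open>The exponential series converges uniformly on the compact \<open>K\<close>, and
  \<open>\<Lambda>\<close> respects such limits. Hence integrals of exponentials are generating
  functions of moments.\<close>

lemma exp_sums:
  assumes g: "continuous_on UNIV g" and \<psi>: "continuous_on UNIV \<psi>"
  shows "(\<lambda>s. a ^ s / fact s * \<Lambda> (\<lambda>z. g z ^ s * \<psi> z)) sums \<Lambda> (\<lambda>z. exp (a * g z) * \<psi> z)"
proof -
  obtain R where R: "0 \<le> R" "\<And>z. z \<in> K \<Longrightarrow> norm (g z) \<le> R" using bounded_on_K[OF g] by metis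
  obtain B where B: "0 \<le> B" "\<And>z. z \<in> K \<Longrightarrow> norm (\<psi> z) \<le> B" using bounded_on_K[OF \<psi>] by metis
  define f where "f s z = (a * g z) ^ s /\<^sub>R fact s * \<psi> z" for s z
  have "f s z = a ^ s / fact s * (g z ^ s * \<psi> z)" for s z
    by (simp add: f_def scaleR_conv_of_real power_mult_distrib field_simps)
  then have f_eq: "f s = (\<lambda>z. a ^ s / fact s * (g z ^ s * \<psi> z))" for s by blast
  have cont_f: "continuous_on UNIV (f s)" for s
    unfolding f_eq by (intro continuous_intros g \<psi>)
  have "uniform_limit K (\<lambda>n z. \<Sum>s<n. f s z) (\<lambda>z. suminf (\<lambda>s. f s z)) sequentially"
  proof (rule Weierstrass_m_test)
    fix s z assume z: "z \<in> K"
    have "norm (f s z) = (norm a * norm (g z)) ^ s /\<^sub>R fact s * norm (\<psi> z)"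
      by (simp add: f_def norm_mult norm_power)
    also have "\<dots> \<le> (norm a * R) ^ s /\<^sub>R fact s * B"
      using R B z by (intro mult_mono scaleR_left_mono power_mono mult_left_mono) auto
    finally show "norm (f s z) \<le> (norm a * R) ^ s /\<^sub>R fact s * B" .
  next
    show "summable (\<lambda>s. (norm a * R) ^ s /\<^sub>R fact s * B)"
      by (intro summable_mult2 summable_exp_generic)
  qed
  moreover have "suminf (\<lambda>s. f s z) = exp (a * g z) * \<psi> z" for z
    using sums_mult2[OF exp_converges, of "a * g z" "\<psi> z"] by (simp add: f_def sums_iff)
  ultimately have "(\<lambda>n. \<Lambda> (\<lambda>z. \<Sum>s<n. f s z)) \<longlonglongrightarrow> \<Lambda> (\<lambda>z. exp (a * g z) * \<psi> z)"
    by (intro tendsto_of_uniform_limit continuous_on_sum cont_f) (auto intro!: continuous_intros g \<psi>)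
  moreover have "\<Lambda> (\<lambda>z. \<Sum>s<n. f s z) = (\<Sum>s<n. a ^ s / fact s * \<Lambda> (\<lambda>z. g z ^ s * \<psi> z))" for n
  proof -
    have "\<Lambda> (\<lambda>z. \<Sum>s<n. f s z) = (\<Sum>s<n. \<Lambda> (f s))" by (intro sum cont_f)
    also have "\<dots> = (\<Sum>s<n. a ^ s / fact s * \<Lambda> (\<lambda>z. g z ^ s * \<psi> z))"
      unfolding f_eq by (intro sum.cong refl cmult) (intro continuous_intros g \<psi>)
    finally show ?thesis .
  qed
  ultimately show ?thesis by (simp add: sums_def)
qed

lemma exp_entire:
  assumes "continuous_on UNIV g" "continuous_on UNIV \<psi>"
  shows "(\<lambda>a. \<Lambda> (\<lambda>z. exp (a * g z) * \<psi> z)) holomorphic_on UNIV"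
proof -
  have "(\<lambda>a. \<Lambda> (\<lambda>z. exp (a * g z) * \<psi> z)) holomorphic_on ball 0 (norm w + 1)" for w :: complex
  proof (rule power_series_holomorphic)
    fix a :: complex
    have "(\<lambda>s. \<Lambda> (\<lambda>z. g z ^ s * \<psi> z) / fact s * (a - 0) ^ s) = (\<lambda>s. a ^ s / fact s * \<Lambda> (\<lambda>z. g z ^ s * \<psi> z))"
      by (rule ext) simp
    then show "(\<lambda>s. \<Lambda> (\<lambda>z. g z ^ s * \<psi> z) / fact s * (a - 0) ^ s) sums \<Lambda> (\<lambda>z. exp (a * g z) * \<psi> z)"
      using exp_sums[OF assms, of a] by (simp only:)
  qed
  then have "(\<lambda>a. \<Lambda> (\<lambda>z. exp (a * g z) * \<psi> z)) field_differentiable at w" for w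
    by (rule holomorphic_on_imp_differentiable_at[of _ "ball 0 (norm w + 1)"]) auto
  then show ?thesis by (simp add: holomorphic_on_def field_differentiable_at_within)
qed

lemma exp_eq_0:
  assumes "continuous_on UNIV g" "continuous_on UNIV \<psi>" "\<And>a. \<Lambda> (\<lambda>z. exp (a * g z) * \<psi> z) = 0"
  shows "\<Lambda> (\<lambda>z. g z ^ s * \<psi> z) = 0"
proof (cases "s = 0")
  case True
  then show ?thesis using assms(3)[of 0] by simp
next
  case False
  show ?thesis
  proof (rule ccontr)
    assume "\<Lambda> (\<lambda>z. g z ^ s * \<psi> z) \<noteq> 0"
    then have nz: "\<Lambda> (\<lambda>z. g z ^ s * \<psi> z) / fact s \<noteq> 0" by simp
    have "(\<lambda>n. \<Lambda> (\<lambda>z. g z ^ n * \<psi> z) / fact n * (a - 0) ^ n) = (\<lambda>n. a ^ n / fact n * \<Lambda> (\<lambda>z. g z ^ n * \<psi> z))" for a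
      by (rule ext) simp
    then have ps: "(\<lambda>n. \<Lambda> (\<lambda>z. g z ^ n * \<psi> z) / fact n * (a - 0) ^ n) sums (\<lambda>_. 0) a" for a
      using exp_sums[OF assms(1,2), of a] unfolding assms(3) by (simp only:)
    \<comment> \<open>A nonzero coefficient of positive index would isolate the zero at the origin
      of the function that is constantly \<open>0\<close>; hence the absurd
      \<open>0 \<noteq> 0\<close> on a punctured disk, refuted at the point
      \<open>d\<close>.\<close>
    have "\<exists>d>0. \<forall>z \<in> cball 0 d - {0 :: complex}. (0 :: complex) \<noteq> 0"
    proof (rule powser_0_nonzero[of 1 0 "\<lambda>n. \<Lambda> (\<lambda>z. g z ^ n * \<psi> z) / fact n" "\<lambda>_. 0" s])
      fix d :: real assume "0 < d" "\<And>z :: complex. z \<in> cball 0 d - {0} \<Longrightarrow> (0 :: complex) \<noteq> 0"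
      then show "\<exists>d>0. \<forall>z \<in> cball 0 d - {0 :: complex}. (0 :: complex) \<noteq> 0"
        by (intro exI[of _ d] conjI ballI)
    qed (use ps nz False in auto)
    then obtain d where "0 < d" and d: "\<And>z :: complex. z \<notin> cball 0 d - {0}" by auto
    have "complex_of_real d \<in> cball 0 d - {0}" using \<open>0 < d\<close> by simp
    with d show False by blast
  qed
qed

text \<open>Conjugation turns exponentials in \<open>cnj z\<close> into exponentials in
  \<open>z\<close>, so that \<open>exp_entire\<close> also covers the column factor at
  \<open>b = - cnj a\<close>.\<close>

lemma conj_functional: "compact_functional (\<lambda>\<phi>. cnj (\<Lambda> (\<lambda>z. cnj (\<phi> z)))) K C"
proof
  show "compact K" "0 \<le> C" by (rule compact_K, rule C_nonneg)
  fix \<phi> \<psi> :: "complex \<Rightarrow> complex" and c B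
  assume \<phi>: "continuous_on UNIV \<phi>"
  then have c\<phi>: "continuous_on UNIV (\<lambda>z. cnj (\<phi> z))" by (intro continuous_intros)
  show "cnj (\<Lambda> (\<lambda>z. cnj (c * \<phi> z))) = c * cnj (\<Lambda> (\<lambda>z. cnj (\<phi> z)))"
    using cmult[OF c\<phi>, of "cnj c"] by simp
  show "cnj (\<Lambda> (\<lambda>z. cnj (\<phi> z + \<psi> z))) = cnj (\<Lambda> (\<lambda>z. cnj (\<phi> z))) + cnj (\<Lambda> (\<lambda>z. cnj (\<psi> z)))"
    if "continuous_on UNIV \<psi>"
    using add[OF c\<phi>, of "\<lambda>z. cnj (\<psi> z)"] that by (simp add: continuous_on_cnj)
  show "norm (cnj (\<Lambda> (\<lambda>z. cnj (\<phi> z)))) \<le> C * B" if "\<And>z. z \<in> K \<Longrightarrow> norm (\<phi> z) \<le> B" "0 \<le> B"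
    using bound[OF c\<phi>, of B] that by simp
qed

definition moment :: "nat \<Rightarrow> nat \<Rightarrow> complex" where
  "moment x y = \<Lambda> (\<lambda>z. z ^ x * cnj z ^ y)"

text \<open>The factorization is summed against \<open>a ^ s / fact s\<close> in the row index and
  then against \<open>b ^ s / fact s\<close> in the column index; \<open>D\<close> depends on
  neither and survives both summations.\<close>

lemma exp_factorization:
  fixes r :: nat and m k :: "nat \<Rightarrow> nat"
  assumes fac: "\<And>x y. moment x y = (\<Sum>j<r. \<Sum>i<r. moment x (k j) * D j i * moment (m i) y)"
  shows "\<Lambda> (\<lambda>z. exp (b * cnj z) * (exp (a * z) * (z ^ n * cnj z ^ l))) =
    (\<Sum>j<r. \<Sum>i<r. \<Lambda> (\<lambda>z. exp (a * z) * (z ^ n * cnj z ^ k j)) * D j i *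
       \<Lambda> (\<lambda>z. exp (b * cnj z) * (z ^ m i * cnj z ^ l)))"
proof -
  have *: "(\<lambda>s. a ^ s / fact s * moment (s + n) y) sums \<Lambda> (\<lambda>z. exp (a * z) * (z ^ n * cnj z ^ y))" for y
    using exp_sums[of "\<lambda>z. z" "\<lambda>z. z ^ n * cnj z ^ y" a]
    by (simp add: moment_def power_add mult.assoc continuous_intros)
  have **: "(\<lambda>s. b ^ s / fact s * moment x (s + l)) sums \<Lambda> (\<lambda>z. exp (b * cnj z) * (z ^ x * cnj z ^ l))" for x
    using exp_sums[of cnj "\<lambda>z. z ^ x * cnj z ^ l" b]
    by (simp add: moment_def power_add mult.left_commute continuous_intros)
  have step: "\<Lambda> (\<lambda>z. exp (a * z) * (z ^ n * cnj z ^ y)) =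
      (\<Sum>j<r. \<Sum>i<r. \<Lambda> (\<lambda>z. exp (a * z) * (z ^ n * cnj z ^ k j)) * D j i * moment (m i) y)" for y
  proof (rule sums_unique2[OF *])
    have "(\<lambda>s. \<Sum>j<r. \<Sum>i<r. a ^ s / fact s * moment (s + n) (k j) * D j i * moment (m i) y) sums
      (\<Sum>j<r. \<Sum>i<r. \<Lambda> (\<lambda>z. exp (a * z) * (z ^ n * cnj z ^ k j)) * D j i * moment (m i) y)"
      by (intro sums_sum sums_mult2 *)
    then show "(\<lambda>s. a ^ s / fact s * moment (s + n) y) sums
      (\<Sum>j<r. \<Sum>i<r. \<Lambda> (\<lambda>z. exp (a * z) * (z ^ n * cnj z ^ k j)) * D j i * moment (m i) y)"
      by (subst fac) (simp add: sum_distrib_left mult.assoc)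
  qed
  have "(\<lambda>s. b ^ s / fact s * \<Lambda> (\<lambda>z. exp (a * z) * (z ^ n * cnj z ^ (s + l)))) sums
      \<Lambda> (\<lambda>z. exp (b * cnj z) * (exp (a * z) * (z ^ n * cnj z ^ l)))"
    using exp_sums[of cnj "\<lambda>z. exp (a * z) * (z ^ n * cnj z ^ l)" b]
    by (simp add: power_add mult.left_commute continuous_intros)
  moreover have "(\<lambda>s. \<Sum>j<r. \<Sum>i<r. \<Lambda> (\<lambda>z. exp (a * z) * (z ^ n * cnj z ^ k j)) * D j i *
      (b ^ s / fact s * moment (m i) (s + l))) sums
    (\<Sum>j<r. \<Sum>i<r. \<Lambda> (\<lambda>z. exp (a * z) * (z ^ n * cnj z ^ k j)) * D j i *
       \<Lambda> (\<lambda>z. exp (b * cnj z) * (z ^ m i * cnj z ^ l)))"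
    by (intro sums_sum sums_mult **)
  moreover have "b ^ s / fact s * \<Lambda> (\<lambda>z. exp (a * z) * (z ^ n * cnj z ^ (s + l))) =
      (\<Sum>j<r. \<Sum>i<r. \<Lambda> (\<lambda>z. exp (a * z) * (z ^ n * cnj z ^ k j)) * D j i *
      (b ^ s / fact s * moment (m i) (s + l)))" for s
    unfolding step[of "s + l"] sum_distrib_left by (intro sum.cong refl) simp
  ultimately show ?thesis by (simp add: sums_unique2)
qed

end

section \<open>An annihilating polynomial, and density of polynomials in \<open>z\<close> and
  \<open>cnj z\<close>\<close>

context compact_functional
begin

text \<open>
  Along \<open>b = - cnj a\<close> the function \<open>exp (a z + b cnj z)\<close> is unimodular, so the factorization of
  the exponential moments bounds a product of two entire functions; by Liouville it is constant,
  and Cramer's rule then makes the coefficients of a linear relation between the rows constant.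
\<close>

lemma annihilating_poly:
  assumes minors: "\<And>m k. arr_det N (\<lambda>i j. moment (m i) (k j)) = 0"
  obtains f :: "complex poly" where "f \<noteq> 0" "\<And>u y. \<Lambda> (\<lambda>z. poly f z * (z ^ u * cnj z ^ y)) = 0"
proof -
  \<comment> \<open>The number \<open>r\<close> below is the rank of the moment matrix. The least
    vanishing size is not \<open>0\<close>, because the empty minor is \<open>1\<close>.\<close>
  define vanish where "vanish n \<longleftrightarrow> (\<forall>m k. arr_det n (\<lambda>i j. moment (m i) (k j)) = 0)" for n
  have "vanish N" using minors by (simp add: vanish_def)
  then have vanish_Least: "vanish (LEAST n. vanish n)" by (rule LeastI)
  then have "(LEAST n. vanish n) \<noteq> 0" by (metis arr_det_0 vanish_def zero_neq_one)
  then obtain r where r: "(LEAST n. vanish n) = Suc r" by (meson not0_implies_Suc)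
  then have "\<not> vanish r" using not_less_Least[of r vanish] by simp
  then obtain m k where nz: "arr_det r (\<lambda>i j. moment (m i) (k j)) \<noteq> 0" by (auto simp: vanish_def)
  have "arr_det (Suc r) (\<lambda>i j. moment (m i) (k j)) = 0" for m k
    using vanish_Least r by (simp add: vanish_def)
  then obtain D where
    fac: "\<And>x y. moment x y = (\<Sum>j<r. \<Sum>i<r. moment x (k j) * D j i * moment (m i) y)"
    using rank_factorization[of r moment m k] nz by blast

  \<comment> \<open>\<open>U\<close> is a generating function along rows, \<open>V\<close> along
    columns and \<open>W\<close> along both. The factorization reads \<open>W = U D V\<close>, so
    determinants multiply.\<close>
  define U where "U n j a = \<Lambda> (\<lambda>z. exp (a * z) * (z ^ n * cnj z ^ k j))" for n j a
  define V where "V i j b = \<Lambda> (\<lambda>z. exp (b * cnj z) * (z ^ m i * cnj z ^ k j))" for i j b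
  define W where "W n j a b = \<Lambda> (\<lambda>z. exp (b * cnj z) * (exp (a * z) * (z ^ n * cnj z ^ k j)))" for n j a b
  define X where "X f a = arr_det r (\<lambda>i j. U (f i) j a)" for f a
  define Y where "Y b = arr_det r (\<lambda>i j. V i j b)" for b
  define \<Delta> where "\<Delta> = arr_det r D"
  define A where "A = arr_det r (\<lambda>i j. moment (m i) (k j))"
  have "A \<noteq> 0" using nz by (simp add: A_def)
  have W_fac: "arr_det r (\<lambda>i j. W (f i) j a b) = X f a * \<Delta> * Y b" for f a b
  proof -
    have "W (f i) j a b = (\<Sum>t<r. (\<Sum>s<r. U (f i) s a * D s t) * V t j b)" for i j
      unfolding W_def U_def V_def exp_factorization[OF fac]
      by (subst sum.swap) (simp add: sum_distrib_right)
    then show ?thesis by (simp add: arr_det_mult X_def Y_def \<Delta>_def)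
  qed
  \<comment> \<open>At \<open>a = b = 0\<close> the product formula becomes
    \<open>A = A * \<Delta> * A\<close>, which excludes \<open>\<Delta> = 0\<close>.\<close>
  have at_0: "X m 0 = A" "Y 0 = A" "arr_det r (\<lambda>i j. W (m i) j 0 0) = A"
    by (simp_all add: X_def Y_def U_def V_def W_def A_def moment_def)
  with W_fac[of m 0 0] \<open>A \<noteq> 0\<close> have "\<Delta> \<noteq> 0" by auto

  \<comment> \<open>\<open>Y (- cnj a)\<close> is antiholomorphic in \<open>a\<close>; conjugating
    it restores holomorphy without changing the modulus.\<close>
  define h where "h a = cnj (Y (- cnj a))" for a
  define P where "P f a = X f a * h a" for f a
  have "h holomorphic_on UNIV"
  proof -
    interpret conj: compact_functional "\<lambda>\<phi>. cnj (\<Lambda> (\<lambda>z. cnj (\<phi> z)))" K C by (rule conj_functional)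
    have "(\<lambda>a. cnj (V i j (- cnj a))) holomorphic_on UNIV" for i j
      using conj.exp_entire[of "\<lambda>z. - z" "\<lambda>z. cnj (z ^ m i * cnj z ^ k j)"]
      by (simp add: V_def exp_cnj continuous_intros)
    then have "(\<lambda>a. arr_det r (\<lambda>i j. cnj (V i j (- cnj a)))) holomorphic_on UNIV"
      by (rule holomorphic_on_arr_det)
    then show ?thesis by (simp add: h_def[abs_def] Y_def cnj_arr_det)
  qed
  moreover have "X f holomorphic_on UNIV" for f
    unfolding X_def[abs_def] U_def
    by (intro holomorphic_on_arr_det exp_entire[of "\<lambda>z. z", simplified] continuous_intros)
  ultimately have P_entire: "P f holomorphic_on UNIV" for f
    unfolding P_def[abs_def] by (intro holomorphic_on_mult)
  have P_const: "P f a = P f 0" for f a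
  proof -
    have "\<exists>B. \<forall>a. norm (W (f i) j a (- cnj a)) \<le> B" for i j
    proof -
      have cont: "continuous_on UNIV (\<lambda>z :: complex. z ^ f i * cnj z ^ k j)" by (intro continuous_intros)
      obtain B where B: "0 \<le> B" "\<And>z. z \<in> K \<Longrightarrow> norm (z ^ f i * cnj z ^ k j) \<le> B"
        using bounded_on_K[OF cont] by metis
      have unimodular: "norm (exp (- cnj a * cnj z) * (exp (a * z) * w)) = norm w" for a z w :: complex
        by (simp add: norm_mult mult.assoc[symmetric] exp_add[symmetric])
      have "norm (W (f i) j a (- cnj a)) \<le> C * B" for a
        unfolding W_def using B by (intro bound continuous_intros) (auto simp only: unimodular)
      then show ?thesis by blast
    qed
    then obtain B where B: "\<And>a. norm (arr_det r (\<lambda>i j. W (f i) j a (- cnj a))) \<le> B"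
      using bounded_arr_det[of "\<lambda>a i j. W (f i) j a (- cnj a)" r] by blast
    have "norm (P f a) \<le> B / norm \<Delta>" for a
      using B[of a] \<open>\<Delta> \<noteq> 0\<close> by (simp add: W_fac P_def h_def norm_mult field_simps)
    then have "bounded (range (P f))" by (auto simp: bounded_iff)
    with P_entire have "P f constant_on UNIV" by (rule Liouville_theorem)
    then show ?thesis by (auto simp: constant_on_def)
  qed
  \<comment> \<open>\<open>P m 0\<close> equals \<open>A * cnj A\<close>. As \<open>P m\<close> is
    constant, neither factor has a zero, so the rows \<open>m i\<close> stay independent for every
    \<open>a\<close>.\<close>
  have "P m 0 \<noteq> 0" using at_0 \<open>A \<noteq> 0\<close> by (simp add: P_def h_def)
  then have X_nz: "X m a \<noteq> 0" and h_nz: "h a \<noteq> 0" for a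
    using P_const[of m a] by (auto simp: P_def)

  \<comment> \<open>Any row index off the chosen ones will do: it keeps the coefficient
    \<open>1\<close> of \<open>f\<close> at \<open>M\<close> from cancelling.\<close>
  obtain M where M: "M \<notin> m ` {..<r}"
    using ex_new_if_finite[of "m ` {..<r}"] by auto
  \<comment> \<open>Cramer's quotient is \<open>X (m(i := M)) a / X m a\<close>. Expanding it by
    \<open>h a\<close> gives a quotient of constants, evaluated here at
    \<open>a = 0\<close>.\<close>
  define \<gamma> where "\<gamma> i = P (m(i := M)) 0 / P m 0" for i
  have rel: "U M j a = (\<Sum>i<r. \<gamma> i * U (m i) j a)" if "j < r" for j a
  proof -
    have "arr_det r (\<lambda>i j. U (m i) j a) \<noteq> 0" using X_nz by (simp add: X_def)
    then obtain x where x: "\<And>j. j < r \<Longrightarrow> U M j a = (\<Sum>i<r. x i * U (m i) j a)"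
      by (rule arr_det_solve[where b = "\<lambda>j. U M j a"]) blast
    have "x i = \<gamma> i" if "i < r" for i
    proof -
      have "X (m(i := M)) a = arr_det r ((\<lambda>i j. U (m i) j a)(i := \<lambda>j. U M j a))"
        unfolding X_def by (intro arr_det_cong) auto
      also have "\<dots> = x i * X m a" using arr_det_cramer[OF that x] by (simp add: X_def)
      finally have "P (m(i := M)) a = x i * P m a" by (simp add: P_def)
      then show ?thesis using \<open>P m 0 \<noteq> 0\<close> P_const[of m a] P_const[of "m(i := M)" a] by (simp add: \<gamma>_def)
    qed
    then show ?thesis using x[OF that] by simp
  qed

  define f where "f = monom 1 M - (\<Sum>i<r. monom (\<gamma> i) (m i))"
  have "coeff f M = 1" using M by (auto simp: f_def coeff_sum intro!: sum.neutral)
  then have "f \<noteq> 0" by auto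
  have lin: "\<Lambda> (\<lambda>z. poly f z * \<psi> z) = \<Lambda> (\<lambda>z. z ^ M * \<psi> z) - (\<Sum>i<r. \<gamma> i * \<Lambda> (\<lambda>z. z ^ m i * \<psi> z))"
    if \<psi>: "continuous_on UNIV \<psi>" for \<psi>
  proof -
    have "\<Lambda> (\<lambda>z. poly f z * \<psi> z) = \<Lambda> (\<lambda>z. z ^ M * \<psi> z - (\<Sum>i<r. \<gamma> i * (z ^ m i * \<psi> z)))"
      by (simp add: f_def poly_sum poly_monom left_diff_distrib sum_distrib_right mult.assoc)
    also have "\<dots> = \<Lambda> (\<lambda>z. z ^ M * \<psi> z) - \<Lambda> (\<lambda>z. \<Sum>i<r. \<gamma> i * (z ^ m i * \<psi> z))"
      by (intro diff continuous_intros \<psi>)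
    also have "\<Lambda> (\<lambda>z. \<Sum>i<r. \<gamma> i * (z ^ m i * \<psi> z)) = (\<Sum>i<r. \<Lambda> (\<lambda>z. \<gamma> i * (z ^ m i * \<psi> z)))"
      by (intro sum continuous_intros \<psi>)
    also have "\<dots> = (\<Sum>i<r. \<gamma> i * \<Lambda> (\<lambda>z. z ^ m i * \<psi> z))"
      by (intro sum.cong refl cmult continuous_intros \<psi>)
    finally show ?thesis .
  qed
  have lin_moment: "\<Lambda> (\<lambda>z. poly f z * (z ^ u * cnj z ^ y)) =
      moment (u + M) y - (\<Sum>i<r. \<gamma> i * moment (u + m i) y)" for u y
    by (subst lin) (auto simp: moment_def power_add ac_simps intro!: continuous_intros)
  \<comment> \<open>The relation holds for all \<open>a\<close>, so its Taylor coefficients yield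
    every power \<open>z ^ u\<close>, so far only for the columns \<open>k j\<close>.\<close>
  have at_k: "\<Lambda> (\<lambda>z. poly f z * (z ^ u * cnj z ^ k j)) = 0" if "j < r" for u j
  proof -
    have "\<Lambda> (\<lambda>z. exp (a * z) * (poly f z * cnj z ^ k j)) = 0" for a
    proof -
      have "\<Lambda> (\<lambda>z. poly f z * (exp (a * z) * cnj z ^ k j)) = U M j a - (\<Sum>i<r. \<gamma> i * U (m i) j a)"
        by (subst lin) (auto simp: U_def ac_simps intro!: continuous_intros)
      also have "\<dots> = 0" using rel[OF that] by simp
      finally show ?thesis by (simp add: ac_simps)
    qed
    then have "\<Lambda> (\<lambda>z. z ^ u * (poly f z * cnj z ^ k j)) = 0"
      by (intro exp_eq_0[of "\<lambda>z. z"] continuous_intros)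
    then show ?thesis by (simp add: ac_simps)
  qed
  \<comment> \<open>The factorization expresses column \<open>y\<close> through the columns
    \<open>k j\<close>, which spreads the vanishing to all \<open>y\<close>.\<close>
  have "\<Lambda> (\<lambda>z. poly f z * (z ^ u * cnj z ^ y)) = 0" for u y
  proof -
    have "(\<Sum>s<r. \<gamma> s * moment (u + m s) y) =
        (\<Sum>j<r. \<Sum>i<r. (\<Sum>s<r. \<gamma> s * moment (u + m s) (k j)) * D j i * moment (m i) y)"
    proof -
      have "(\<Sum>s<r. \<gamma> s * moment (u + m s) y) =
          (\<Sum>s<r. \<gamma> s * (\<Sum>j<r. \<Sum>i<r. moment (u + m s) (k j) * D j i * moment (m i) y))"
        by (intro sum.cong refl arg_cong2[of _ _ _ _ "(*)"] fac)
      also have "\<dots> = (\<Sum>j<r. \<Sum>s<r. \<Sum>i<r. \<gamma> s * (moment (u + m s) (k j) * D j i * moment (m i) y))"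
        unfolding sum_distrib_left by (rule sum.swap)
      also have "\<dots> = (\<Sum>j<r. \<Sum>i<r. \<Sum>s<r. \<gamma> s * (moment (u + m s) (k j) * D j i * moment (m i) y))"
        by (intro sum.cong refl sum.swap)
      finally show ?thesis by (simp add: sum_distrib_right mult.assoc)
    qed
    then have "\<Lambda> (\<lambda>z. poly f z * (z ^ u * cnj z ^ y)) =
        (\<Sum>j<r. \<Sum>i<r. (moment (u + M) (k j) - (\<Sum>s<r. \<gamma> s * moment (u + m s) (k j))) * D j i * moment (m i) y)"
      unfolding lin_moment fac[of "u + M" y] by (simp add: left_diff_distrib sum_subtractf)
    also have "\<dots> = 0"
      unfolding lin_moment[symmetric] by (simp add: at_k)
    finally show ?thesis .
  qed
  with \<open>f \<noteq> 0\<close> show thesis by (rule that)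
qed

text \<open>The weight \<open>\<zeta>\<close> is kept arbitrary in the induction so that, for a
  product, the first factor can be absorbed into it.\<close>

lemma vanish_real_polynomial:
  assumes "real_polynomial_function p" "continuous_on UNIV \<zeta>"
    "\<And>u y. \<Lambda> (\<lambda>z. \<zeta> z * (z ^ u * cnj z ^ y)) = 0"
  shows "\<Lambda> (\<lambda>z. \<zeta> z * complex_of_real (p z) * (z ^ u * cnj z ^ y)) = 0"
  using assms
proof (induction p arbitrary: \<zeta> u y rule: real_polynomial_function.induct)
  case (linear p)
  \<comment> \<open>Substitute \<open>(z + cnj z) / 2\<close> for \<open>Re z\<close> and
    \<open>(z - cnj z) / (2 i)\<close> for \<open>Im z\<close> in
    \<open>p z = Re z * p 1 + Im z * p i\<close>.\<close>
  define \<alpha> where "\<alpha> = (complex_of_real (p 1) - \<i> * complex_of_real (p \<i>)) / 2"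
  define \<beta> where "\<beta> = (complex_of_real (p 1) + \<i> * complex_of_real (p \<i>)) / 2"
  have p: "complex_of_real (p z) = \<alpha> * z + \<beta> * cnj z" for z
  proof -
    interpret bounded_linear p by (rule linear)
    have "z = Re z *\<^sub>R 1 + Im z *\<^sub>R \<i>" by (simp add: complex_eq_iff)
    then have "p z = Re z * p 1 + Im z * p \<i>" by (metis add scaleR real_scaleR_def)
    then show ?thesis by (simp add: \<alpha>_def \<beta>_def complex_eq_iff field_simps)
  qed
  have "\<zeta> z * complex_of_real (p z) * (z ^ u * cnj z ^ y) =
     \<alpha> * (\<zeta> z * (z ^ Suc u * cnj z ^ y)) + \<beta> * (\<zeta> z * (z ^ u * cnj z ^ Suc y))" for z
    by (simp add: p algebra_simps)
  then have "\<Lambda> (\<lambda>z. \<zeta> z * complex_of_real (p z) * (z ^ u * cnj z ^ y)) =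
     \<Lambda> (\<lambda>z. \<alpha> * (\<zeta> z * (z ^ Suc u * cnj z ^ y)) + \<beta> * (\<zeta> z * (z ^ u * cnj z ^ Suc y)))" by presburger
  also have "\<dots> = \<Lambda> (\<lambda>z. \<alpha> * (\<zeta> z * (z ^ Suc u * cnj z ^ y))) + \<Lambda> (\<lambda>z. \<beta> * (\<zeta> z * (z ^ u * cnj z ^ Suc y)))"
    by (intro add continuous_intros linear.prems)
  also have "\<Lambda> (\<lambda>z. \<alpha> * (\<zeta> z * (z ^ Suc u * cnj z ^ y))) = \<alpha> * \<Lambda> (\<lambda>z. \<zeta> z * (z ^ Suc u * cnj z ^ y))"
    by (intro cmult continuous_intros linear.prems)
  also have "\<Lambda> (\<lambda>z. \<beta> * (\<zeta> z * (z ^ u * cnj z ^ Suc y))) = \<beta> * \<Lambda> (\<lambda>z. \<zeta> z * (z ^ u * cnj z ^ Suc y))"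
    by (intro cmult continuous_intros linear.prems)
  finally show ?case unfolding linear.prems(2) by simp
next
  case (const c)
  have "\<Lambda> (\<lambda>z. complex_of_real c * (\<zeta> z * (z ^ u * cnj z ^ y))) = complex_of_real c * \<Lambda> (\<lambda>z. \<zeta> z * (z ^ u * cnj z ^ y))"
    by (intro cmult continuous_intros const.prems)
  then show ?case unfolding const.prems(2) by (simp add: ac_simps)
next
  case (add p q)
  have cont: "continuous_on UNIV p" "continuous_on UNIV q"
    using add.hyps continuous_on_polymonial_function real_polynomial_function_eq by blast+
  have "\<Lambda> (\<lambda>z. \<zeta> z * complex_of_real (p z) * (z ^ u * cnj z ^ y) + \<zeta> z * complex_of_real (q z) * (z ^ u * cnj z ^ y)) =
    \<Lambda> (\<lambda>z. \<zeta> z * complex_of_real (p z) * (z ^ u * cnj z ^ y)) + \<Lambda> (\<lambda>z. \<zeta> z * complex_of_real (q z) * (z ^ u * cnj z ^ y))"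
    by (intro compact_functional.add[OF compact_functional_axioms] continuous_intros add.prems cont)
  then show ?case using add.IH[OF add.prems] by (simp add: distrib_left distrib_right)
next
  case (mult p q)
  have "continuous_on UNIV p"
    using mult.hyps continuous_on_polymonial_function real_polynomial_function_eq by blast
  then have "\<Lambda> (\<lambda>z. (\<zeta> z * complex_of_real (p z)) * complex_of_real (q z) * (z ^ u * cnj z ^ y)) = 0"
    using mult.prems mult.IH(1)[OF mult.prems] by (intro mult.IH(2) continuous_intros) auto
  then show ?case by (simp add: ac_simps)
qed

lemma vanish_real_continuous:
  fixes \<phi> :: "complex \<Rightarrow> real"
  assumes \<zeta>: "continuous_on UNIV \<zeta>" "\<And>u y. \<Lambda> (\<lambda>z. \<zeta> z * (z ^ u * cnj z ^ y)) = 0"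
    and \<phi>: "continuous_on UNIV \<phi>"
  shows "\<Lambda> (\<lambda>z. \<zeta> z * complex_of_real (\<phi> z)) = 0"
proof -
  obtain B where B: "0 \<le> B" "\<And>z. z \<in> K \<Longrightarrow> norm (\<zeta> z) \<le> B" using bounded_on_K[OF \<zeta>(1)] by metis
  have "norm (\<Lambda> (\<lambda>z. \<zeta> z * complex_of_real (\<phi> z))) \<le> e" if "0 < e" for e
  proof -
    define d where "d = e / (C * B + 1)"
    have pos: "0 < C * B + 1" using B C_nonneg by (simp add: add_nonneg_pos)
    then have d: "0 < d" using that by (simp add: d_def)
    have "continuous_on K \<phi>" using \<phi> continuous_on_subset by blast
    then obtain p where p: "real_polynomial_function p" "\<And>z. z \<in> K \<Longrightarrow> \<bar>\<phi> z - p z\<bar> < d"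
      using Stone_Weierstrass_real_polynomial_function[OF compact_K _ d] by metis
    have cont: "continuous_on UNIV p"
      using p(1) continuous_on_polymonial_function real_polynomial_function_eq by blast
    have "\<Lambda> (\<lambda>z. \<zeta> z * complex_of_real (\<phi> z)) - \<Lambda> (\<lambda>z. \<zeta> z * complex_of_real (p z)) =
        \<Lambda> (\<lambda>z. \<zeta> z * complex_of_real (\<phi> z) - \<zeta> z * complex_of_real (p z))"
      by (intro diff[symmetric] continuous_intros \<zeta> \<phi> cont)
    moreover have "\<Lambda> (\<lambda>z. \<zeta> z * complex_of_real (p z)) = 0"
      using vanish_real_polynomial[OF p(1) \<zeta>, of 0 0] by simp
    ultimately have "\<Lambda> (\<lambda>z. \<zeta> z * complex_of_real (\<phi> z)) = \<Lambda> (\<lambda>z. \<zeta> z * complex_of_real (\<phi> z - p z))"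
      by (simp add: right_diff_distrib)
    also have "norm \<dots> \<le> C * (B * d)"
    proof (intro bound continuous_intros \<zeta> \<phi> cont)
      show "norm (\<zeta> z * complex_of_real (\<phi> z - p z)) \<le> B * d" if "z \<in> K" for z
        unfolding norm_mult norm_of_real using B p(2)[OF that] that by (intro mult_mono) auto
    qed (use B d in auto)
    also have "\<dots> \<le> (C * B + 1) * d" using d by (simp add: algebra_simps)
    also have "\<dots> = e" using pos by (simp add: d_def)
    finally show ?thesis .
  qed
  then have "norm (\<Lambda> (\<lambda>z. \<zeta> z * complex_of_real (\<phi> z))) \<le> 0"
    by (rule field_le_epsilon) simp
  then show ?thesis by simp
qed

lemma vanish_continuous:
  assumes \<zeta>: "continuous_on UNIV \<zeta>" "\<And>u y. \<Lambda> (\<lambda>z. \<zeta> z * (z ^ u * cnj z ^ y)) = 0"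
    and \<phi>: "continuous_on UNIV \<phi>"
  shows "\<Lambda> (\<lambda>z. \<zeta> z * \<phi> z) = 0"
proof -
  have "\<zeta> z * \<phi> z = \<zeta> z * complex_of_real (Re (\<phi> z)) + \<i> * (\<zeta> z * complex_of_real (Im (\<phi> z)))" for z
    by (subst complex_eq[of "\<phi> z"]) (simp add: algebra_simps)
  then have "\<Lambda> (\<lambda>z. \<zeta> z * \<phi> z) =
      \<Lambda> (\<lambda>z. \<zeta> z * complex_of_real (Re (\<phi> z)) + \<i> * (\<zeta> z * complex_of_real (Im (\<phi> z))))" by presburger
  also have "\<dots> = \<Lambda> (\<lambda>z. \<zeta> z * complex_of_real (Re (\<phi> z))) + \<Lambda> (\<lambda>z. \<i> * (\<zeta> z * complex_of_real (Im (\<phi> z))))"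
    by (intro add continuous_intros \<zeta> \<phi>)
  also have "\<Lambda> (\<lambda>z. \<i> * (\<zeta> z * complex_of_real (Im (\<phi> z)))) = \<i> * \<Lambda> (\<lambda>z. \<zeta> z * complex_of_real (Im (\<phi> z)))"
    by (intro cmult continuous_intros \<zeta> \<phi>)
  finally show ?thesis
    by (simp add: vanish_real_continuous[OF \<zeta>] continuous_on_Re continuous_on_Im \<phi>)
qed

end

section \<open>Finite rank forces finite support, and conversely\<close>

lemma summable_on_UN_finite:
  fixes f :: "'a \<Rightarrow> real"
  assumes "finite I" "\<And>i. i \<in> I \<Longrightarrow> f summable_on A i"
  shows "f summable_on (\<Union>i\<in>I. A i)"
  using assms by (induction I) (auto intro!: summable_on_union)

lemma sum_functions_apply: "(\<Sum>i\<in>I. f i) x = (\<Sum>i\<in>I. f i x)"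
  by (induction I rule: infinite_finite_induct) auto

context compact_complex_measure
begin

lemma weighted_functional:
  assumes w: "continuous_on UNIV w"
  obtains C where "compact_functional (\<lambda>\<phi>. L (\<lambda>z. w z * \<phi> z)) K C"
proof -
  obtain C where C: "0 \<le> C"
    "\<And>\<phi> B. \<phi> \<in> borel_measurable borel \<Longrightarrow> (\<And>x. x \<in> K \<Longrightarrow> norm (\<phi> x) \<le> B) \<Longrightarrow> 0 \<le> B \<Longrightarrow> norm (L \<phi>) \<le> C * B"
    using L_bound by blast
  obtain B where B: "0 \<le> B" "\<And>z. z \<in> K \<Longrightarrow> norm (w z) \<le> B"
    using admissible_boundE[OF admissible_continuous[OF w]] by metis
  have "compact_functional (\<lambda>\<phi>. L (\<lambda>z. w z * \<phi> z)) K (C * B)"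
  proof
    show "compact K" by (rule compact_support)
    show "0 \<le> C * B" using B C by simp
    fix \<phi> \<psi> :: "complex \<Rightarrow> complex" and c D
    assume \<phi>: "continuous_on UNIV \<phi>"
    show "L (\<lambda>z. w z * (\<phi> z + \<psi> z)) = L (\<lambda>z. w z * \<phi> z) + L (\<lambda>z. w z * \<psi> z)" if "continuous_on UNIV \<psi>"
      unfolding distrib_left by (intro L_add admissible_continuous continuous_intros w \<phi> that)
    show "L (\<lambda>z. w z * (c * \<phi> z)) = c * L (\<lambda>z. w z * \<phi> z)"
      using L_cmult[of c "\<lambda>z. w z * \<phi> z"] by (simp add: mult.left_commute)
    show "norm (L (\<lambda>z. w z * \<phi> z)) \<le> C * B * D" if "\<And>z. z \<in> K \<Longrightarrow> norm (\<phi> z) \<le> D" "0 \<le> D"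
    proof -
      have "norm (L (\<lambda>z. w z * \<phi> z)) \<le> C * (B * D)"
      proof (rule C(2))
        show "(\<lambda>z. w z * \<phi> z) \<in> borel_measurable borel"
          by (intro borel_measurable_continuous_onI continuous_intros w \<phi>)
        show "norm (w z * \<phi> z) \<le> B * D" if "z \<in> K" for z
          unfolding norm_mult using B \<open>\<And>z. z \<in> K \<Longrightarrow> norm (\<phi> z) \<le> D\<close> that by (intro mult_mono) auto
      qed (use B that in simp)
      then show ?thesis by (simp add: mult.assoc)
    qed
  qed
  then show thesis by (rule that)
qed

text \<open>The sequence is the moment sequence of the push-forward of \<open>z ^ x * cnj z ^ y \<nu>\<close> under \<open>z \<mapsto> \<bar>z\<bar>\<^sup>2\<close>.\<close>

lemma tame_moment: "tame (\<lambda>l. L (\<lambda>z. z ^ (x + l) * cnj z ^ (y + l)))"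
proof -
  have cont: "continuous_on UNIV (\<lambda>z :: complex. z ^ x * cnj z ^ y)" by (intro continuous_intros)
  obtain C where "compact_functional (\<lambda>\<phi>. L (\<lambda>z. (z ^ x * cnj z ^ y) * \<phi> z)) K C"
    using weighted_functional[OF cont] by metis
  then interpret compact_functional "\<lambda>\<phi>. L (\<lambda>z. (z ^ x * cnj z ^ y) * \<phi> z)" K C .
  have cont2: "continuous_on UNIV (\<lambda>z :: complex. z * cnj z)" by (intro continuous_intros)
  obtain R where R: "0 \<le> R" "\<And>z. z \<in> K \<Longrightarrow> norm (z * cnj z) \<le> R"
    using bounded_on_K[OF cont2] by metis
  show ?thesis
  \<comment> \<open>The interval must have positive length, and \<open>R\<close> may be
    \<open>0\<close>.\<close>
  proof (rule tameI[of C "R + 1"])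
    fix n c B
    assume *: "\<And>t. t \<in> {0..R + 1} \<Longrightarrow> norm (\<Sum>l\<le>n. c l * complex_of_real t ^ l) \<le> B"
    have "0 \<le> B" using order_trans[OF norm_ge_zero *[of 0]] R(1) by simp
    have "(\<Sum>l\<le>n. c l * L (\<lambda>z. z ^ (x + l) * cnj z ^ (y + l))) =
        (\<Sum>l\<le>n. L (\<lambda>z. z ^ x * cnj z ^ y * (c l * (z * cnj z) ^ l)))"
      unfolding L_cmult[symmetric] by (simp add: power_add power_mult_distrib ac_simps)
    also have "\<dots> = L (\<lambda>z. z ^ x * cnj z ^ y * (\<Sum>l\<le>n. c l * (z * cnj z) ^ l))"
      by (intro sum[symmetric] continuous_intros)
    also have "norm \<dots> \<le> C * B"
    proof (intro bound continuous_intros)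
      fix z assume "z \<in> K"
      have z: "z * cnj z = complex_of_real (norm (z * cnj z))"
        using complex_norm_square[of z] by (simp add: norm_mult power2_eq_square)
      have "norm (\<Sum>l\<le>n. c l * complex_of_real (norm (z * cnj z)) ^ l) \<le> B"
        using R(2)[OF \<open>z \<in> K\<close>] by (intro *) simp
      then show "norm (\<Sum>l\<le>n. c l * (z * cnj z) ^ l) \<le> B" by (subst z)
    qed (rule \<open>0 \<le> B\<close>)
    finally show "norm (\<Sum>l\<le>n. c l * L (\<lambda>z. z ^ (x + l) * cnj z ^ (y + l))) \<le> C * B" .
  qed (use C_nonneg R in auto)
qed

lemma toeplitz_monomials:
  assumes "m \<notin> S" "k \<notin> S"
  shows "toeplitz \<nu> (monomial_span S) (monom 1 m) (\<lambda>z. cnj (poly (monom 1 k) z)) = L (\<lambda>z. z ^ m * cnj z ^ k)"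
proof -
  have "monom 1 k \<in> monomial_span S"
    unfolding monomial_span_def using assms(2) by (intro poly_vs.span_base) auto
  then have "(\<lambda>z. cnj (poly (monom 1 k) z)) \<in> conj_space (monomial_span S)"
    by (auto simp: conj_space_def)
  then show ?thesis by (simp add: toeplitz_def poly_monom)
qed

lemma vanishing_minors:
  assumes S: "(\<lambda>s. 1 / (real s + 1)) summable_on S"
    and rank: "finite_rank (monomial_span S) (toeplitz \<nu> (monomial_span S))"
  obtains n where "\<And>m k. arr_det n (\<lambda>i j. L (\<lambda>z. z * cnj z * (z ^ m i * cnj z ^ k j))) = 0"
proof -
  let ?N = "monomial_span S"
  obtain B where B: "finite B" "functional_vs.span B = toeplitz \<nu> ?N ` ?N"
    using rank by (auto simp: finite_rank_def)
  have "\<exists>u. m \<notin> S \<longrightarrow> (\<forall>k. k \<notin> S \<longrightarrow> L (\<lambda>z. z ^ m * cnj z ^ k) = (\<Sum>b\<in>B. u b * b (\<lambda>z. cnj (poly (monom 1 k) z))))" for m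
  proof (cases "m \<in> S")
    case False
    have "monom 1 m \<in> ?N"
      unfolding monomial_span_def using False by (intro poly_vs.span_base) auto
    then have "toeplitz \<nu> ?N (monom 1 m) \<in> functional_vs.span B" using B(2) by blast
    then obtain u where "toeplitz \<nu> ?N (monom 1 m) = (\<Sum>b\<in>B. (\<lambda>h. u b * b h))"
      unfolding functional_vs.span_finite[OF B(1)] by blast
    then show ?thesis
      using toeplitz_monomials[OF False, symmetric] by (intro exI[of _ u]) (simp add: sum_functions_apply)
  qed simp
  then have "\<exists>u. \<forall>m. m \<notin> S \<longrightarrow> (\<forall>k. k \<notin> S \<longrightarrow>
      L (\<lambda>z. z ^ m * cnj z ^ k) = (\<Sum>b\<in>B. u m b * b (\<lambda>z. cnj (poly (monom 1 k) z))))"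
    by (intro choice allI)
  then obtain u where u: "\<And>m k. m \<notin> S \<Longrightarrow> k \<notin> S \<Longrightarrow>
      L (\<lambda>z. z ^ m * cnj z ^ k) = (\<Sum>b\<in>B. u m b * b (\<lambda>z. cnj (poly (monom 1 k) z)))"
    by blast
  \<comment> \<open>The range is spanned by \<open>card B\<close> functionals, so minors of the next
    size vanish whenever their indices avoid \<open>S\<close>.\<close>
  define n where "n = Suc (card B)"
  have "arr_det n (\<lambda>i j. L (\<lambda>z. z * cnj z * (z ^ m i * cnj z ^ k j))) = 0" for m k :: "nat \<Rightarrow> nat"
  proof -
    define G where "G l = arr_det n (\<lambda>i j. L (\<lambda>z. z ^ (m i + l) * cnj z ^ (k j + l)))" for l
    \<comment> \<open>These are the shifts that push some row or column index into \<open>S\<close>: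
      finitely many translates of \<open>S\<close>, hence still summable.\<close>
    define A where "A = (\<Union>i\<in>{..<n}. {l. m i + l \<in> S}) \<union> (\<Union>j\<in>{..<n}. {l. k j + l \<in> S})"
    have "tame G" unfolding G_def[abs_def] by (intro tame_arr_det tame_moment)
    moreover have "(\<lambda>s. 1 / (real s + 1)) summable_on A"
      unfolding A_def by (intro summable_on_union summable_on_UN_finite summable_on_shift S) auto
    moreover have "G l = 0" if "l \<notin> A" for l
      unfolding G_def
    proof (rule arr_det_low_rank[OF B(1)])
      show "card B < n" by (simp add: n_def)
      fix i j assume "i < n" "j < n"
      then have "m i + l \<notin> S" "k j + l \<notin> S" using that by (auto simp: A_def)
      then show "L (\<lambda>z. z ^ (m i + l) * cnj z ^ (k j + l)) =
          (\<Sum>b\<in>B. u (m i + l) b * b (\<lambda>z. cnj (poly (monom 1 (k j + l)) z)))" by (rule u)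
    qed
    ultimately have "G 1 = 0" by (rule tame_eq_0)
    then show ?thesis by (simp add: G_def ac_simps)
  qed
  then show thesis by (rule that)
qed

text \<open>The indicator of \<open>E \<inter> {z. F z \<noteq> 0}\<close> is a bounded pointwise
  limit of continuous multiples of \<open>F\<close>: a cutoff shrinking to \<open>E\<close> times
  \<open>|F|^2 / (|F|^2 + 1 / (n + 1))\<close>, where \<open>|F|^2 = F * cnj F\<close> supplies the
  factor \<open>F\<close>.\<close>

lemma vanish_closed:
  assumes F: "continuous_on UNIV F" and zero: "\<And>\<phi>. continuous_on UNIV \<phi> \<Longrightarrow> L (\<lambda>z. F z * \<phi> z) = 0"
    and "closed E"
  shows "\<nu> (E \<inter> {z. F z \<noteq> 0}) = 0"
proof (cases "E = {}")
  \<comment> \<open>\<open>infdist z {}\<close> is \<open>0\<close>, so for empty \<open>E\<close>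
    the cutoff used below would be \<open>1\<close> everywhere.\<close>
  case True
  then show ?thesis by (simp add: complex_measure_empty[OF \<nu>])
next
  case False
  let ?D = "\<lambda>n z. (norm (F z))\<^sup>2 + 1 / real (Suc n)"
  define g where "g n z = max 0 (1 - real n * infdist z E) * ((norm (F z))\<^sup>2 / ?D n z)" for n z
  have pos: "0 < ?D n z" for n z by (intro add_nonneg_pos) auto
  have ne: "?D n z \<noteq> 0" for n z using pos by (rule less_imp_neq[symmetric])
  have cont: "continuous_on UNIV (g n)" for n
    unfolding g_def[abs_def] by (intro continuous_intros F ballI ne)
  have L_g: "L (\<lambda>z. complex_of_real (g n z)) = 0" for n
  proof -
    define \<phi> where "\<phi> z = complex_of_real (max 0 (1 - real n * infdist z E) / ?D n z) * cnj (F z)" for z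
    have "continuous_on UNIV \<phi>"
      unfolding \<phi>_def[abs_def] by (intro continuous_intros F ballI ne)
    then have "L (\<lambda>z. F z * \<phi> z) = 0" by (rule zero)
    moreover have "F z * \<phi> z = complex_of_real (g n z)" for z
      by (simp add: \<phi>_def g_def complex_norm_square[symmetric] mult.left_commute del: of_real_power)
    ultimately show ?thesis by simp
  qed
  have "(\<lambda>n. L (\<lambda>z. complex_of_real (g n z))) \<longlonglongrightarrow> L (indicator (E \<inter> {z. F z \<noteq> 0}))"
  proof (rule L_dominated_convergence[where B = 1])
    show "(\<lambda>z. complex_of_real (g n z)) \<in> borel_measurable borel" for n
      by (intro borel_measurable_continuous_onI continuous_intros cont)
    have "{z. F z \<noteq> 0} \<in> sets borel" using F by (intro borel_open open_Collect_neq continuous_on_const)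
    then show "indicator (E \<inter> {z. F z \<noteq> 0}) \<in> borel_measurable borel"
      using borel_closed[OF \<open>closed E\<close>] by (intro borel_measurable_indicator sets.Int)
    show "norm (complex_of_real (g n z)) \<le> 1" for n z
    proof -
      have "(norm (F z))\<^sup>2 / ?D n z \<le> 1" unfolding divide_le_eq_1_pos[OF pos] by simp
      moreover have "max 0 (1 - real n * infdist z E) \<le> 1" by (simp add: infdist_nonneg)
      ultimately have "g n z \<le> 1 * 1" unfolding g_def by (intro mult_mono) auto
      moreover have "0 \<le> g n z" unfolding g_def by (intro mult_nonneg_nonneg divide_nonneg_pos pos) auto
      ultimately show ?thesis by simp
    qed
    show "(\<lambda>n. complex_of_real (g n z)) \<longlonglongrightarrow> indicator (E \<inter> {z. F z \<noteq> 0}) z" for z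
    proof (cases "z \<in> E")
      case True
      show ?thesis
      proof (cases "F z = 0")
        case True
        then show ?thesis by (simp add: g_def)
      next
        case False
        have "(\<lambda>n. ?D n z) \<longlonglongrightarrow> (norm (F z))\<^sup>2 + 0"
          by (intro tendsto_add tendsto_const lim_1_over_n[THEN LIMSEQ_Suc])
        then have "(\<lambda>n. (norm (F z))\<^sup>2 / ?D n z) \<longlonglongrightarrow> (norm (F z))\<^sup>2 / ((norm (F z))\<^sup>2 + 0)"
          using False by (intro tendsto_divide tendsto_const) auto
        then have "(\<lambda>n. complex_of_real (g n z)) \<longlonglongrightarrow> complex_of_real 1"
          using True False by (intro tendsto_of_real) (simp add: g_def)
        then show ?thesis using True False by simp
      qed
    next
      case out: False
      then have d: "0 < infdist z E" using \<open>closed E\<close> False by (simp add: infdist_pos_not_in_closed)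
      obtain n0 where n0: "1 < real n0 * infdist z E" using reals_Archimedean3[OF d] by blast
      have "complex_of_real (g n z) = 0" if "n0 \<le> n" for n
      proof -
        have "real n0 * infdist z E \<le> real n * infdist z E" using that d by (intro mult_right_mono) auto
        then show ?thesis using n0 by (simp add: g_def)
      qed
      then have "\<forall>\<^sub>F n in sequentially. complex_of_real (g n z) = 0" by (auto simp: eventually_sequentially)
      then show ?thesis using out by (simp add: tendsto_eventually)
    qed
  qed
  then have "L (indicator (E \<inter> {z. F z \<noteq> 0})) = 0" unfolding L_g by (simp add: LIMSEQ_const_iff)
  moreover have "E \<inter> {z. F z \<noteq> 0} \<in> sets borel"
    using F \<open>closed E\<close> by (intro sets.Int borel_open borel_closed open_Collect_neq continuous_on_const)
  ultimately show ?thesis by (simp add: L_indicator)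
qed

text \<open>Closed sets form an intersection-stable generator. Complements are handled by the closed
  set \<open>UNIV\<close>, disjoint unions by countable additivity.\<close>

lemma vanish_borel:
  assumes F: "continuous_on UNIV F" and zero: "\<And>\<phi>. continuous_on UNIV \<phi> \<Longrightarrow> L (\<lambda>z. F z * \<phi> z) = 0"
    and "E \<in> sets borel"
  shows "\<nu> (E \<inter> {z. F z \<noteq> 0}) = 0"
proof -
  let ?U = "{z. F z \<noteq> 0}"
  have U: "?U \<in> sets borel" using F by (intro borel_open open_Collect_neq continuous_on_const)
  have borel_closed_sets: "sets borel = sigma_sets UNIV (Collect closed :: complex set set)"
    using borel_eq_closed by (metis sets_measure_of subset_Pow_Union top_greatest sets_measure_of Pow_UNIV)
  have "Int_stable (Collect closed :: complex set set)" by (auto simp: Int_stable_def)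
  moreover have "Collect closed \<subseteq> Pow (UNIV :: complex set)" by simp
  moreover have "E \<in> sigma_sets UNIV (Collect closed)" using assms(3) borel_closed_sets by simp
  ultimately show ?thesis
  proof (induction rule: sigma_sets_induct_disjoint)
    case (basic A)
    then show ?case using vanish_closed[OF F zero] by simp
  next
    case empty
    then show ?case by (simp add: complex_measure_empty[OF \<nu>])
  next
    case (compl A)
    then have A: "A \<in> sets borel" using borel_closed_sets by simp
    have U0: "\<nu> ?U = 0" using vanish_closed[OF F zero, of UNIV] by simp
    have eq: "(UNIV - A) \<inter> ?U = ?U - A \<inter> ?U" by blast
    have "Re (\<nu> (?U - A \<inter> ?U)) = Re (\<nu> ?U) - Re (\<nu> (A \<inter> ?U))" "Im (\<nu> (?U - A \<inter> ?U)) = Im (\<nu> ?U) - Im (\<nu> (A \<inter> ?U))"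
      using A U by (intro Re.Diff Im.Diff; auto)+
    then show ?case unfolding eq using compl U0 by (simp add: complex_eq_iff)
  next
    case (union A)
    have "A i \<in> sets borel" for i using union(2) borel_closed_sets by auto
    then have "range (\<lambda>i. A i \<inter> ?U) \<subseteq> sets borel" using U by auto
    moreover have "disjoint_family (\<lambda>i. A i \<inter> ?U)" by (rule disjoint_family_subset[OF union(1)]) auto
    ultimately have "(\<lambda>i. \<nu> (A i \<inter> ?U)) sums \<nu> (\<Union>i. A i \<inter> ?U)" by (rule complex_measure_sums[OF \<nu>])
    then show ?case using union(3) by (simp add: sums_iff)
  qed
qed

lemma finite_support_if_finite_rank:
  assumes S: "(\<lambda>s. 1 / (real s + 1)) summable_on S"
    and rank: "finite_rank (monomial_span S) (toeplitz \<nu> (monomial_span S))"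
  shows "finite K"
proof -
  obtain n where minors: "\<And>m k. arr_det n (\<lambda>i j. L (\<lambda>z. z * cnj z * (z ^ m i * cnj z ^ k j))) = 0"
    using vanishing_minors[OF S rank] by blast
  have cont: "continuous_on UNIV (\<lambda>z :: complex. z * cnj z)" by (intro continuous_intros)
  obtain C where "compact_functional (\<lambda>\<phi>. L (\<lambda>z. z * cnj z * \<phi> z)) K C"
    using weighted_functional[OF cont] by metis
  then interpret compact_functional "\<lambda>\<phi>. L (\<lambda>z. z * cnj z * \<phi> z)" K C .
  have "arr_det n (\<lambda>i j. moment (m i) (k j)) = 0" for m k
    using minors by (simp add: moment_def)
  then obtain f :: "complex poly" where "f \<noteq> 0" and f: "\<And>u y. L (\<lambda>z. z * cnj z * (poly f z * (z ^ u * cnj z ^ y))) = 0"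
    using annihilating_poly[of n] by blast
  define F where "F z = z * cnj z * poly f z" for z
  have F_cont: "continuous_on UNIV F" unfolding F_def[abs_def] by (intro continuous_intros)
  have F_zero: "L (\<lambda>z. F z * \<phi> z) = 0" if "continuous_on UNIV \<phi>" for \<phi>
    using vanish_continuous[OF _ f that] by (simp add: F_def mult.assoc continuous_intros)
  \<comment> \<open>The open set where \<open>F\<close> is nonzero has only null Borel subsets, so
    it has no total variation and misses the support.\<close>
  have "K \<subseteq> {z. F z = 0}"
  proof (rule ccontr)
    assume "\<not> K \<subseteq> {z. F z = 0}"
    then obtain x where x: "x \<in> K" "F x \<noteq> 0" by blast
    let ?U = "{z. F z \<noteq> 0}"
    have "open ?U" using F_cont by (intro open_Collect_neq continuous_on_const)
    have "\<nu> E = 0" if "E \<in> sets borel" "E \<subseteq> ?U" for E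
      using vanish_borel[OF F_cont F_zero that(1)] that(2) by (simp add: Int_absorb2)
    then have "emeasure (total_variation borel \<nu>) ?U = 0"
      using \<open>open ?U\<close> total_variation_eq_0_iff[OF \<nu>, of ?U] by auto
    then show False using x \<open>open ?U\<close> by (auto simp: measure_support_def)
  qed
  moreover have "{z. F z = 0} \<subseteq> insert 0 {z. poly f z = 0}" by (auto simp: F_def)
  ultimately show ?thesis
    using poly_roots_finite[OF \<open>f \<noteq> 0\<close>] by (meson finite.insertI finite_subset)
qed

lemma finite_rank_if_finite_support:
  assumes "finite K"
  shows "finite_rank (monomial_span S) (toeplitz \<nu> (monomial_span S))"
proof -
  let ?N = "monomial_span S"
  let ?T = "toeplitz \<nu> ?N"
  \<comment> \<open>Evaluation at \<open>x\<close>, set to \<open>0\<close> outside the conjugate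
    space to match the representation of functionals.\<close>
  define e where "e x = (\<lambda>h. if h \<in> conj_space ?N then h x else 0 :: complex)" for x :: complex
  have L_finite: "L \<phi> = (\<Sum>x\<in>K. \<phi> x * \<nu> {x})" if \<phi>: "continuous_on UNIV \<phi>" for \<phi>
  proof -
    have adm: "admissible (\<lambda>z. \<phi> x * indicator {x} z)" for x
      by (intro admissibleI[of _ "norm (\<phi> x)"]) (auto simp: norm_mult indicator_def)
    have "L \<phi> = L (\<lambda>z. \<Sum>x\<in>K. \<phi> x * indicator {x} z)"
      using assms by (intro L_cong admissible_continuous admissible_sum adm \<phi>) (simp add: indicator_def if_distrib cong: if_cong)
    also have "\<dots> = (\<Sum>x\<in>K. L (\<lambda>z. \<phi> x * indicator {x} z))" by (intro L_sum adm)
    also have "\<dots> = (\<Sum>x\<in>K. \<phi> x * \<nu> {x})" by (simp add: L_cmult L_indicator)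
    finally show ?thesis .
  qed
  have T_apply: "?T f h = (\<Sum>x\<in>K. \<nu> {x} * poly f x * e x h)" for f h
  proof (cases "h \<in> conj_space ?N")
    case True
    then obtain g where "h = (\<lambda>z. cnj (poly g z))" by (auto simp: conj_space_def)
    then have "continuous_on UNIV (\<lambda>z. poly f z * h z)" by (simp add: continuous_intros)
    then show ?thesis using True L_finite by (simp add: toeplitz_def e_def ac_simps)
  next
    case False
    then show ?thesis by (simp add: toeplitz_def e_def)
  qed
  have T_eq: "?T f = (\<Sum>x\<in>K. (\<lambda>h. \<nu> {x} * poly f x * e x h))" for f
    by (rule ext) (simp add: T_apply sum_functions_apply)
  have range: "?T ` ?N \<subseteq> functional_vs.span (e ` K)"
  proof (rule image_subsetI)
    fix f
    show "?T f \<in> functional_vs.span (e ` K)"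
      unfolding T_eq
    proof (rule functional_vs.span_sum)
      fix x assume "x \<in> K"
      then have "e x \<in> functional_vs.span (e ` K)" by (intro functional_vs.span_base imageI)
      then show "(\<lambda>h. \<nu> {x} * poly f x * e x h) \<in> functional_vs.span (e ` K)"
        by (rule functional_vs.span_scale)
    qed
  qed
  have N: "poly_vs.subspace ?N" by (simp add: monomial_span_def)
  have subspace: "functional_vs.subspace (?T ` ?N)"
  proof (rule functional_vs.subspaceI)
    have "?T 0 = 0" by (rule ext) (simp add: T_apply)
    then show "0 \<in> ?T ` ?N" using poly_vs.subspace_0[OF N] by (metis image_eqI)
  next
    fix u v assume "u \<in> ?T ` ?N" "v \<in> ?T ` ?N"
    then obtain f g where fg: "f \<in> ?N" "g \<in> ?N" "u = ?T f" "v = ?T g" by auto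
    have "u + v = ?T (f + g)" unfolding fg by (rule ext) (simp add: T_apply sum.distrib[symmetric] algebra_simps)
    then show "u + v \<in> ?T ` ?N" using poly_vs.subspace_add[OF N fg(1,2)] by blast
  next
    fix c u assume "u \<in> ?T ` ?N"
    then obtain f where f: "f \<in> ?N" "u = ?T f" by auto
    have "(\<lambda>h. c * u h) = ?T (Polynomial.smult c f)"
      unfolding f by (rule ext) (simp add: T_apply sum_distrib_left ac_simps)
    then show "(\<lambda>h. c * u h) \<in> ?T ` ?N" using poly_vs.subspace_scale[OF N f(1)] by blast
  qed
  obtain B where B: "B \<subseteq> ?T ` ?N" "functional_vs.independent B" "?T ` ?N \<subseteq> functional_vs.span B"
    by (rule functional_vs.maximal_independent_subset)
  have "finite B"
    using functional_vs.independent_span_bound[of "e ` K" B] assms B range by blast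
  moreover have "functional_vs.span B = ?T ` ?N" using B subspace by (intro functional_vs.span_subspace)
  ultimately show ?thesis by (auto simp: finite_rank_def)
qed

end

theorem theorem3p1:
  fixes S :: "nat set" and \<nu> :: "complex set \<Rightarrow> complex"
  assumes "(\<lambda>s. 1 / (real s + 1)) summable_on S"
    and "complex_measure borel \<nu>"
    and "regular_complex_measure \<nu>"
    and "compact (measure_support \<nu>)"
  shows "finite_rank (monomial_span S) (toeplitz \<nu> (monomial_span S)) \<longleftrightarrow>
         finite (measure_support \<nu>)"
proof -
  interpret compact_complex_measure \<nu> using assms(2,4) by unfold_locales
  show ?thesis using finite_support_if_finite_rank[OF assms(1)] finite_rank_if_finite_support by blast
qed

end
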